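(* Let $g,n\ge 0$ be integers with $2g-2+n\geq 1$, and let $M_{g,n}^{\rm trop}$ be the topological space defined in the context. Then: (1) The points of $M_{g,n}^{\rm trop}$ bijectively parametrize isomorphism classes of $n$-pointed (weighted) tropical curves of genus $g$ (up to tropical equivalence), i.e. isomorphism classes of stable metric weighted graphs of genus $g$ with $n$ labeled legs. (2) Let $M_{g,n}^{\rm reg}\subset M_{g,n}^{\rm trop}$ be the subset parametrizing regular curves, i.e. $$M_{g,n}^{\rm reg}=\bigsqcup_{\Gamma\ 3\text{-regular},\ b_1(\Gamma)=g,\ |L(\Gamma)|=n} M^{\rm trop}(\Gamma,\underline 0)\subset M_{g,n}^{\rm trop}.$$ Then $M_{g,n}^{\rm reg}$ is open and dense in $M_{g,n}^{\rm trop}$. (3) Let $M_{g,n}^{\rm pure}\subset M_{g,n}^{\rm trop}$ be the subset parametrizing pure tropical curves. Then $M_{g,n}^{\rm pure}$ is open and dense in $M_{g,n}^{\rm trop}$. (4) $M_{g,n}^{\rm trop}$ is Hausdorff.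
   Context: Graphs. A graph $\Gamma$ with $n$ legs consists of a finite nonempty set $V(\Gamma)$ of vertices, a finite set $H(\Gamma)$ of half-edges, an involution $h\mapsto\overline h$ of $H(\Gamma)$ with exactly $n$ fixed points (the legs, forming the set $L(\Gamma)=\{x_1,\dots,x_n\}$, which are labeled), and an endpoint map $\epsilon:H(\Gamma)\to V(\Gamma)$. An edge is a pair $\{h,\overline h\}$ with $h\neq\overline h$; $E(\Gamma)$ is the set of edges. All graphs are connected. The valence of $v$ is $|\epsilon^{-1}(v)|$; $\Gamma$ is 3-regular if all vertices have valence 3. $b_1(\Gamma)=|E(\Gamma)|-|V(\Gamma)|+1$ is the first Betti number. Weighted graphs. A weighted graph is a pair $(\Gamma,w)$ with $w:V(\Gamma)\to\mathbb Z_{\ge 0}$; its genus is $b_1(\Gamma)+\sum_v w(v)$. It is stable if every vertex of weight 0 has valence $\ge 3$ and every vertex of weight 1 has valence $\ge 1$. $\underline 0$ denotes the zero weight function. For $S\subset E(\Gamma)$, the weighted contraction $(\Gamma_{/S},w_{/S})$ is obtained by contracting every edge of $S$ (with contraction map $\sigma:\Gamma\to\Gamma_{/S}$, so $E(\Gamma_{/S})=E(\Gamma)\smallsetminus S$ and the legs are unchanged) and setting $w_{/S}(\overline v)=b_1(\sigma^{-1}(\overline v))+\sum_{v\in V(\Gamma),\,\sigma(v)=\overline v}w(v)$. It has the same genus, and is stable if $(\Gamma,w)$ is. Tropical curves. Up to tropical equivalence, an $n$-pointed (weighted) tropical curve of genus $g$ is a stable metric weighted graph, i.e. a triple $(\Gamma,w,\ell)$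 with $(\Gamma,w)$ a stable graph of genus $g$ with $n$ labeled legs and $\ell:E(\Gamma)\to\mathbb R_{>0}$ (legs have length $\infty$). Isomorphisms are isomorphisms of graphs (bijections on vertices and half-edges compatible with involution and endpoints) preserving weights and lengths and sending the $i$-th leg to the $i$-th leg. A tropical curve is pure if $w=\underline 0$, and regular if it is pure and $\Gamma$ is 3-regular. Moduli. For a stable $(\Gamma,w)$ put $R(\Gamma,w)=\mathbb R_{>0}^{E(\Gamma)}$ and $\overline{R(\Gamma,w)}=\mathbb R_{\ge 0}^{E(\Gamma)}$ with the euclidean topology. A point $p=(t_e)_{e\in E(\Gamma)}\in\overline{R(\Gamma,w)}$ determines the tropical curve $(\Gamma_{/S},w_{/S},\ell_p)$ with $S=\{e: t_e=0\}$ and $\ell_p(e)=t_e$ for $e\notin S$. Write $p\sim q$ if the corresponding tropical curves are isomorphic, and let $\overline{M^{\rm trop}(\Gamma,w)}=\overline{R(\Gamma,w)}/\sim$ with the quotient topology. $M^{\rm trop}(\Gamma,w)$ is the set of isomorphism classes of $n$-pointed tropical curves with underlying weighted graph $(\Gamma,w)$, i.e. the image of $R(\Gamma,w)$. Define, with the quotient topology, $$M_{g,n}^{\rm trop}=\Bigl(\bigsqcup_{\Gamma}\overline{M^{\rm trop}(\Gamma,\underline 0)}\Bigr)/\cong\;=\;\Bigl(\bigsqcup_{\Gamma}\overline{R(\Gamma,\underline 0)}\Bigr)/\sim,$$ where $\Gamma$ runs over (isomorphism classes of) 3-regular graphs with $b_1(\Gamma)=g$ and $n$ labeled legs, and points are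 identified when the corresponding tropical curves are isomorphic. *)

theory Defs
  imports "HOL-Analysis.Analysis"
begin

section \<open>Graphs with labelled legs\<close>

text \<open>The fields are only meaningful on the carriers: \<open>opp\<close> (the involution) and \<open>endpt\<close> on
  \<open>hedges\<close>, and \<open>leg i\<close> (the \<open>i\<close>-th leg) for \<open>1 \<le> i \<le> n\<close>, where \<open>n\<close> is the number of legs.\<close>

record ('v, 'h) lgraph =
  verts :: "'v set"
  hedges :: "'h set"
  opp :: "'h \<Rightarrow> 'h"
  endpt :: "'h \<Rightarrow> 'v"
  leg :: "nat \<Rightarrow> 'h"

definition legs :: "('v, 'h) lgraph \<Rightarrow> 'h set" where
  "legs G = {h \<in> hedges G. opp G h = h}"

definition edges :: "('v, 'h) lgraph \<Rightarrow> 'h set set" where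
  "edges G = {{h, opp G h} | h. h \<in> hedges G \<and> opp G h \<noteq> h}"

definition adj :: "('v, 'h) lgraph \<Rightarrow> 'h set set \<Rightarrow> ('v \<times> 'v) set" where
  "adj G S = {(endpt G h, endpt G (opp G h)) | h. h \<in> hedges G \<and> {h, opp G h} \<in> S}"

definition connected_lgraph :: "('v, 'h) lgraph \<Rightarrow> bool" where
  "connected_lgraph G \<longleftrightarrow> (\<forall>u \<in> verts G. \<forall>v \<in> verts G. (u, v) \<in> (adj G (edges G))\<^sup>*)"

definition is_lgraph :: "('v, 'h) lgraph \<Rightarrow> bool" where
  "is_lgraph G \<longleftrightarrow>
     finite (verts G) \<and> verts G \<noteq> {} \<and> finite (hedges G) \<and>
     (\<forall>h \<in> hedges G. opp G h \<in> hedges G \<and> opp G (opp G h) = h) \<and>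
     (\<forall>h \<in> hedges G. endpt G h \<in> verts G) \<and>
     bij_betw (leg G) {1..card (legs G)} (legs G) \<and>
     connected_lgraph G"

definition valence :: "('v, 'h) lgraph \<Rightarrow> 'v \<Rightarrow> nat" where
  "valence G v = card {h \<in> hedges G. endpt G h = v}"

definition three_regular :: "('v, 'h) lgraph \<Rightarrow> bool" where
  "three_regular G \<longleftrightarrow> (\<forall>v \<in> verts G. valence G v = 3)"

text \<open>This is only applied to connected graphs, for which the subtraction does not truncate.\<close>

definition betti1 :: "('v, 'h) lgraph \<Rightarrow> nat" where
  "betti1 G = card (edges G) + 1 - card (verts G)"

definition lgraph_iso_by ::
  "('v \<Rightarrow> 'w) \<Rightarrow> ('h \<Rightarrow> 'k) \<Rightarrow> ('v, 'h) lgraph \<Rightarrow> ('w, 'k) lgraph \<Rightarrow> bool" where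
  "lgraph_iso_by f a G G' \<longleftrightarrow>
     bij_betw f (verts G) (verts G') \<and> bij_betw a (hedges G) (hedges G') \<and>
     (\<forall>h \<in> hedges G. opp G' (a h) = a (opp G h) \<and> endpt G' (a h) = f (endpt G h)) \<and>
     (\<forall>i \<in> {1..card (legs G)}. a (leg G i) = leg G' i)"

definition lgraph_iso :: "('v, 'h) lgraph \<Rightarrow> ('w, 'k) lgraph \<Rightarrow> bool" where
  "lgraph_iso G G' \<longleftrightarrow> (\<exists>f a. lgraph_iso_by f a G G')"


section \<open>Weights and weighted contraction\<close>

definition genus :: "('v, 'h) lgraph \<Rightarrow> ('v \<Rightarrow> nat) \<Rightarrow> nat" where
  "genus G w = betti1 G + (\<Sum>v\<in>verts G. w v)"

definition stable :: "('v, 'h) lgraph \<Rightarrow> ('v \<Rightarrow> nat) \<Rightarrow> bool" where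
  "stable G w \<longleftrightarrow> (\<forall>v \<in> verts G. (w v = 0 \<longrightarrow> 3 \<le> valence G v) \<and> (w v = 1 \<longrightarrow> 1 \<le> valence G v))"

text \<open>The vertices of a contraction are the vertex sets of the connected components of the
  spanning subgraph with edge set \<open>S\<close>; \<open>contr_map G S\<close> is the contraction map \<open>\<sigma>\<close> on vertices.\<close>

definition contr_map :: "('v, 'h) lgraph \<Rightarrow> 'h set set \<Rightarrow> 'v \<Rightarrow> 'v set" where
  "contr_map G S v = {u \<in> verts G. (v, u) \<in> (adj G S)\<^sup>*}"

definition contract :: "('v, 'h) lgraph \<Rightarrow> 'h set set \<Rightarrow> ('v set, 'h) lgraph" where
  "contract G S =
     \<lparr>verts = contr_map G S ` verts G,
      hedges = {h \<in> hedges G. {h, opp G h} \<notin> S},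
      opp = opp G,
      endpt = (\<lambda>h. contr_map G S (endpt G h)),
      leg = leg G\<rparr>"

text \<open>The connected subgraph \<open>\<sigma>\<^sup>-\<^sup>1(X)\<close> that is contracted to the vertex \<open>X\<close>.\<close>

definition contr_fiber :: "('v, 'h) lgraph \<Rightarrow> 'h set set \<Rightarrow> 'v set \<Rightarrow> ('v, 'h) lgraph" where
  "contr_fiber G S X =
     G\<lparr>verts := {v \<in> verts G. contr_map G S v = X},
       hedges := {h \<in> hedges G. {h, opp G h} \<in> S \<and> contr_map G S (endpt G h) = X}\<rparr>"

definition contract_weight ::
  "('v, 'h) lgraph \<Rightarrow> ('v \<Rightarrow> nat) \<Rightarrow> 'h set set \<Rightarrow> 'v set \<Rightarrow> nat" where
  "contract_weight G w S X =
     betti1 (contr_fiber G S X) + (\<Sum>v | v \<in> verts G \<and> contr_map G S v = X. w v)"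


section \<open>Tropical curves\<close>

type_synonym ('v, 'h) tcurve = "('v, 'h) lgraph \<times> ('v \<Rightarrow> nat) \<times> ('h set \<Rightarrow> real)"

definition tcurves :: "nat \<Rightarrow> nat \<Rightarrow> ('v, 'h) tcurve set" where
  "tcurves g n = {(G, w, l). is_lgraph G \<and> card (legs G) = n \<and> stable G w \<and> genus G w = g \<and>
     (\<forall>e \<in> edges G. 0 < l e)}"

definition tcurve_iso :: "('v, 'h) tcurve \<Rightarrow> ('w, 'k) tcurve \<Rightarrow> bool" where
  "tcurve_iso = (\<lambda>(G, w, l) (G', w', l').
     \<exists>f a. lgraph_iso_by f a G G' \<and> (\<forall>v \<in> verts G. w' (f v) = w v) \<and>
           (\<forall>e \<in> edges G. l' (a ` e) = l e))"

definition tcurve_classes :: "nat \<Rightarrow> nat \<Rightarrow> ('v, 'h) tcurve set set" where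
  "tcurve_classes g n =
     tcurves g n // {(C, D). C \<in> tcurves g n \<and> D \<in> tcurves g n \<and> tcurve_iso C D}"

definition pure :: "('v, 'h) tcurve \<Rightarrow> bool" where
  "pure = (\<lambda>(G, w, l). \<forall>v \<in> verts G. w v = 0)"

definition regular :: "('v, 'h) tcurve \<Rightarrow> bool" where
  "regular = (\<lambda>(G, w, l). pure (G, w, l) \<and> three_regular G)"


section \<open>The moduli space\<close>

definition quotient_topology :: "'a topology \<Rightarrow> ('a \<times> 'a) set \<Rightarrow> 'a set topology" where
  "quotient_topology X r =
     topology (\<lambda>U. U \<subseteq> topspace X // r \<and> openin X {x \<in> topspace X. r `` {x} \<in> U})"

lemma openin_quotient_topology:
  "openin (quotient_topology X r) U \<longleftrightarrow>
     U \<subseteq> topspace X // r \<and> openin X {x \<in> topspace X. r `` {x} \<in> U}"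
proof -
  have "istopology (\<lambda>U. U \<subseteq> topspace X // r \<and> openin X {x \<in> topspace X. r `` {x} \<in> U})"
    unfolding istopology_def
  proof (intro conjI allI impI)
    fix S T
    assume S: "S \<subseteq> topspace X // r \<and> openin X {x \<in> topspace X. r `` {x} \<in> S}"
      and T: "T \<subseteq> topspace X // r \<and> openin X {x \<in> topspace X. r `` {x} \<in> T}"
    then show "S \<inter> T \<subseteq> topspace X // r" by blast
    have "{x \<in> topspace X. r `` {x} \<in> S \<inter> T} =
        {x \<in> topspace X. r `` {x} \<in> S} \<inter> {x \<in> topspace X. r `` {x} \<in> T}" by blast
    with S T show "openin X {x \<in> topspace X. r `` {x} \<in> S \<inter> T}" by auto
  next
    fix K
    assume K: "\<forall>U\<in>K. U \<subseteq> topspace X // r \<and> openin X {x \<in> topspace X. r `` {x} \<in> U}"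
    then show "\<Union> K \<subseteq> topspace X // r" by blast
    have "{x \<in> topspace X. r `` {x} \<in> \<Union> K} = (\<Union>U\<in>K. {x \<in> topspace X. r `` {x} \<in> U})" by blast
    with K show "openin X {x \<in> topspace X. r `` {x} \<in> \<Union> K}" by auto
  qed
  then show ?thesis by (simp add: quotient_topology_def)
qed

lemma topspace_quotient_topology [simp]: "topspace (quotient_topology X r) = topspace X // r"
proof (rule antisym)
  show "topspace (quotient_topology X r) \<subseteq> topspace X // r"
    by (metis openin_quotient_topology openin_topspace)
  have "{x \<in> topspace X. r `` {x} \<in> topspace X // r} = topspace X"
    by (auto intro: quotientI)
  then have "openin (quotient_topology X r) (topspace X // r)"
    by (simp add: openin_quotient_topology)
  then show "topspace X // r \<subseteq> topspace (quotient_topology X r)"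
    by (rule openin_subset)
qed

lemma quotient_map_quotient_topology:
  "quotient_map X (quotient_topology X r) (\<lambda>x. r `` {x})"
  unfolding quotient_map_def by (auto simp: openin_quotient_topology quotient_def)

text \<open>The closed cell of metrics on a graph, possibly with some lengths \<open>0\<close>: the orthant of
  nonnegative real functions on the edges.\<close>

definition Rbar :: "('v, 'h) lgraph \<Rightarrow> ('h set \<Rightarrow> real) topology" where
  "Rbar G = product_topology (\<lambda>_. top_of_set {0..}) (edges G)"

definition Ropen :: "('v, 'h) lgraph \<Rightarrow> ('h set \<Rightarrow> real) set" where
  "Ropen G = {t \<in> topspace (Rbar G). \<forall>e \<in> edges G. 0 < t e}"

definition curve_of ::
  "('v, 'h) lgraph \<Rightarrow> ('v \<Rightarrow> nat) \<Rightarrow> ('h set \<Rightarrow> real) \<Rightarrow> ('v set, 'h) tcurve" where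
  "curve_of G w t = (let S = {e \<in> edges G. t e = 0} in (contract G S, contract_weight G w S, t))"

text \<open>A point of the disjoint union of the closed cells of the graphs with zero weight.\<close>

type_synonym ('v, 'h) mpoint = "('v, 'h) lgraph \<times> ('h set \<Rightarrow> real)"

definition curve_at :: "('v, 'h) mpoint \<Rightarrow> ('v set, 'h) tcurve" where
  "curve_at = (\<lambda>(G, t). curve_of G (\<lambda>_. 0) t)"

definition cubic_graphs :: "nat \<Rightarrow> nat \<Rightarrow> ('v, 'h) lgraph set" where
  "cubic_graphs g n = {G. is_lgraph G \<and> three_regular G \<and> betti1 G = g \<and> card (legs G) = n}"

text \<open>A choice of one graph in every isomorphism class. On an infinite type such as \<^typ>\<open>nat\<close>
  every finite graph has an isomorphic copy, so no isomorphism class is lost by fixing the type.\<close>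

definition cubic_representatives :: "nat \<Rightarrow> nat \<Rightarrow> ('v, 'h) lgraph set \<Rightarrow> bool" where
  "cubic_representatives g n Gs \<longleftrightarrow>
     Gs \<subseteq> cubic_graphs g n \<and>
     (\<forall>G \<in> (cubic_graphs g n :: ('v, 'h) lgraph set). \<exists>!G'. G' \<in> Gs \<and> lgraph_iso G G')"

lemma lgraph_iso_refl: "lgraph_iso G G"
  unfolding lgraph_iso_def lgraph_iso_by_def
  by (rule exI[of _ "\<lambda>x. x"], rule exI[of _ "\<lambda>x. x"]) (auto simp: bij_betw_def)

lemma lgraph_iso_by_legs:
  assumes "is_lgraph G" "lgraph_iso_by f a G G'"
  shows "card (legs G') = card (legs G)"
proof -
  have a: "bij_betw a (hedges G) (hedges G')"
    and opp: "\<And>h. h \<in> hedges G \<Longrightarrow> opp G' (a h) = a (opp G h)"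
    and closed: "\<And>h. h \<in> hedges G \<Longrightarrow> opp G h \<in> hedges G"
    using assms by (auto simp: lgraph_iso_by_def is_lgraph_def)
  have inj: "inj_on a (hedges G)" and im: "a ` hedges G = hedges G'"
    using a by (auto simp: bij_betw_def)
  have fixed_iff: "a (opp G h) = a h \<longleftrightarrow> opp G h = h" if "h \<in> hedges G" for h
    using inj closed that by (auto dest: inj_onD)
  have "a ` legs G = legs G'"
  proof (intro subset_antisym subsetI)
    fix k assume "k \<in> legs G'"
    then have k: "k \<in> a ` hedges G" "opp G' k = k" using im by (auto simp: legs_def)
    then obtain h where h: "h \<in> hedges G" "k = a h" by auto
    then have "a (opp G h) = a h" using k(2) opp[OF h(1)] by simp
    then have "h \<in> legs G" using h(1) fixed_iff[OF h(1)] by (simp add: legs_def)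
    then show "k \<in> a ` legs G" using h(2) by blast
  next
    fix k assume "k \<in> a ` legs G"
    then show "k \<in> legs G'" using im opp by (auto simp: legs_def)
  qed
  moreover have "inj_on a (legs G)"
    using inj by (rule inj_on_subset) (auto simp: legs_def)
  ultimately show ?thesis by (metis card_image)
qed

lemma lgraph_iso_sym:
  assumes "is_lgraph G" "lgraph_iso G G'"
  shows "lgraph_iso G' G"
proof -
  obtain f a where fa: "lgraph_iso_by f a G G'"
    using assms(2) by (auto simp: lgraph_iso_def)
  let ?f = "inv_into (verts G) f" and ?a = "inv_into (hedges G) a"
  have f: "bij_betw f (verts G) (verts G')" and a: "bij_betw a (hedges G) (hedges G')"
    using fa by (auto simp: lgraph_iso_by_def)
  have G: "\<And>h. h \<in> hedges G \<Longrightarrow> opp G h \<in> hedges G" "\<And>h. h \<in> hedges G \<Longrightarrow> endpt G h \<in> verts G"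
    "\<And>i. i \<in> {1..card (legs G)} \<Longrightarrow> leg G i \<in> hedges G"
    using assms(1) by (auto simp: is_lgraph_def legs_def bij_betw_def)
  have inv_a: "\<And>h. h \<in> hedges G \<Longrightarrow> ?a (a h) = h" and inv_f: "\<And>v. v \<in> verts G \<Longrightarrow> ?f (f v) = v"
    using a f by (auto simp: bij_betw_def)
  have "opp G (?a k) = ?a (opp G' k) \<and> endpt G (?a k) = ?f (endpt G' k)" if k: "k \<in> hedges G'" for k
  proof -
    obtain h where "h \<in> hedges G" "k = a h" using a k by (auto simp: bij_betw_def)
    then show ?thesis using fa G inv_a inv_f by (auto simp: lgraph_iso_by_def)
  qed
  moreover have "?a (leg G' i) = leg G i" if "i \<in> {1..card (legs G')}" for i
  proof -
    have i: "i \<in> {1..card (legs G)}" using that lgraph_iso_by_legs[OF assms(1) fa] by simp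
    then have "leg G' i = a (leg G i)" using fa by (auto simp: lgraph_iso_by_def)
    then show ?thesis using G(3)[OF i] inv_a by simp
  qed
  ultimately have "lgraph_iso_by ?f ?a G' G"
    using f a by (auto simp: lgraph_iso_by_def bij_betw_inv_into)
  then show ?thesis by (auto simp: lgraph_iso_def)
qed

lemma lgraph_iso_trans:
  assumes "is_lgraph G" "lgraph_iso G G'" "lgraph_iso G' G''"
  shows "lgraph_iso G G''"
proof -
  obtain f a f' a' where fa: "lgraph_iso_by f a G G'" "lgraph_iso_by f' a' G' G''"
    using assms by (auto simp: lgraph_iso_def)
  have "card (legs G') = card (legs G)" using lgraph_iso_by_legs[OF assms(1) fa(1)] .
  moreover have "\<And>h. h \<in> hedges G \<Longrightarrow> a h \<in> hedges G'"
    using fa(1) by (auto simp: lgraph_iso_by_def bij_betw_def)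
  moreover have "bij_betw (f' \<circ> f) (verts G) (verts G'')" "bij_betw (a' \<circ> a) (hedges G) (hedges G'')"
    using fa by (meson bij_betw_trans lgraph_iso_by_def)+
  ultimately have "lgraph_iso_by (f' \<circ> f) (a' \<circ> a) G G''"
    using fa by (simp add: lgraph_iso_by_def)
  then show ?thesis by (auto simp: lgraph_iso_def)
qed

lemma ex_cubic_representatives: "\<exists>Gs :: ('v, 'h) lgraph set. cubic_representatives g n Gs"
proof -
  let ?C = "cubic_graphs g n :: ('v, 'h) lgraph set"
  define r where "r = {(G, G'). G \<in> ?C \<and> G' \<in> ?C \<and> lgraph_iso G G'}"
  have C: "is_lgraph G" if "G \<in> ?C" for G using that by (simp add: cubic_graphs_def)
  have eq: "r `` {G} = r `` {G'}" if "(G, G') \<in> r" for G G'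
  proof -
    have G: "is_lgraph G" "is_lgraph G'" "lgraph_iso G G'" "G \<in> ?C" "G' \<in> ?C"
      using that C by (auto simp: r_def)
    have "lgraph_iso G H \<longleftrightarrow> lgraph_iso G' H" for H :: "('v, 'h) lgraph"
      using lgraph_iso_trans[OF G(1,3)] lgraph_iso_trans[OF G(2) lgraph_iso_sym[OF G(1,3)]]
      by blast
    then show ?thesis using G by (simp add: r_def)
  qed
  define rep where "rep G = (SOME G'. G' \<in> r `` {G})" for G
  have rep: "(G, rep G) \<in> r" if "G \<in> ?C" for G
  proof -
    have "G \<in> r `` {G}" using that by (simp add: r_def lgraph_iso_refl)
    then have "rep G \<in> r `` {G}" unfolding rep_def by (rule someI)
    then show ?thesis by simp
  qed
  have "\<exists>!G'. G' \<in> rep ` ?C \<and> lgraph_iso G G'" if G: "G \<in> ?C" for G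
  proof (rule ex1I[of _ "rep G"])
    show "rep G \<in> rep ` ?C \<and> lgraph_iso G (rep G)" using rep[OF G] G by (auto simp: r_def)
  next
    fix G' assume G': "G' \<in> rep ` ?C \<and> lgraph_iso G G'"
    then obtain H where H: "H \<in> ?C" "G' = rep H" by auto
    then have "(G, rep H) \<in> r" using G G' rep[OF H(1)] by (auto simp: r_def)
    then have "r `` {G} = r `` {rep H}" by (rule eq)
    moreover have "r `` {H} = r `` {rep H}" by (rule eq[OF rep[OF H(1)]])
    ultimately have "r `` {G} = r `` {H}" by (rule trans[OF _ sym])
    then show "G' = rep G" unfolding H(2) rep_def by (simp only:)
  qed
  moreover have "rep G \<in> ?C" if "G \<in> ?C" for G using rep[OF that] by (simp add: r_def)
  ultimately have "cubic_representatives g n (rep ` ?C)"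
    unfolding cubic_representatives_def image_subset_iff by simp
  then show ?thesis by (rule exI)
qed

definition Mspace :: "('v, 'h) lgraph set \<Rightarrow> ('v, 'h) mpoint topology" where
  "Mspace Gs = sum_topology Rbar Gs"

definition Mrel :: "('v, 'h) lgraph set \<Rightarrow> (('v, 'h) mpoint \<times> ('v, 'h) mpoint) set" where
  "Mrel Gs = {(x, y). x \<in> topspace (Mspace Gs) \<and> y \<in> topspace (Mspace Gs) \<and>
     tcurve_iso (curve_at x) (curve_at y)}"

definition Mtrop :: "('v, 'h) lgraph set \<Rightarrow> ('v, 'h) mpoint set topology" where
  "Mtrop Gs = quotient_topology (Mspace Gs) (Mrel Gs)"

text \<open>The isomorphism class of tropical curves parametrized by a point of the moduli space. The
  vertices of the curve at a point are sets of vertices, so its class is taken among curves on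
  arbitrary types.\<close>

definition class_at :: "nat \<Rightarrow> nat \<Rightarrow> ('v, 'h) mpoint set \<Rightarrow> ('w, 'k) tcurve set" where
  "class_at g n X = {C \<in> tcurves g n. \<exists>x \<in> X. tcurve_iso (curve_at x) C}"

definition Mreg :: "('v, 'h) lgraph set \<Rightarrow> ('v, 'h) mpoint set set" where
  "Mreg Gs = {X \<in> topspace (Mtrop Gs). \<exists>x \<in> X. regular (curve_at x)}"

definition Mpure :: "('v, 'h) lgraph set \<Rightarrow> ('v, 'h) mpoint set set" where
  "Mpure Gs = {X \<in> topspace (Mtrop Gs). \<exists>x \<in> X. pure (curve_at x)}"

text \<open>The image in the moduli space of the open cell of a graph, that is, the set of classes of
  tropical curves whose underlying weighted graph is \<open>G\<close> with zero weight.\<close>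

definition Mcell :: "('v, 'h) lgraph set \<Rightarrow> ('v, 'h) lgraph \<Rightarrow> ('v, 'h) mpoint set set" where
  "Mcell Gs G = (\<lambda>t. Mrel Gs `` {(G, t)}) ` Ropen G"

end

theory Submission
  imports Defs
begin

text \<open>A contraction is treated as a relation between weighted graphs: half-edges \<open>D\<close> of \<open>G\<close> are
  contracted and the result is identified with \<open>G'\<close>. Such relations compose, and a contraction of \<open>E\<close>
  factors through any contraction of \<open>D \<subseteq> E\<close>; isomorphisms are the case \<open>D = {}\<close>. A point \<open>(G, t)\<close> of
  a closed cell then parametrizes the curve \<open>C\<close> iff \<open>G\<close> contracts to \<open>C\<close> along the zero set of \<open>t\<close> with
  matching lengths.

  Every stable weighted graph is a contraction of a cubic graph of weight zero: trade a unit of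
  weight for a loop, and split a vertex of valence at least four; each step lowers
  \<open>3 \<Sum> w + |H| - 3 |V|\<close> by one. This gives surjectivity in (1). A point is regular iff no length
  vanishes, and a smaller zero set gives smaller weights, so both loci are open, and they are dense
  because the open cells are.

  For the Hausdorff property, the \<open>\<epsilon>\<close>-neighbourhood of a curve \<open>C\<close> consists of the points \<open>(G, t)\<close> for
  which some contraction of \<open>G\<close> to \<open>C\<close> contracts only edges of length below \<open>\<epsilon>\<close> and changes the other
  lengths by less than \<open>\<epsilon>\<close>. It is open, and saturated if \<open>\<epsilon>\<close> is at most the shortest edge of \<open>C\<close>. If
  \<open>2 \<epsilon>\<close> is at most every length and every nonzero difference of lengths of \<open>C\<close> and \<open>C'\<close>, a
  common point of both neighbourhoods forces the same edges to be contracted and the lengths to be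
  equal, so \<open>C\<close> and \<open>C'\<close> are isomorphic.\<close>

section \<open>Contractions as relations\<close>

text \<open>Connectedness and nonemptiness are split off: contractions are composed without them,
  and both properties pass through a contraction in either direction.\<close>

definition pregraph :: "('v, 'h) lgraph \<Rightarrow> bool" where
  "pregraph G \<longleftrightarrow>
     finite (verts G) \<and> finite (hedges G) \<and>
     (\<forall>h \<in> hedges G. opp G h \<in> hedges G \<and> opp G (opp G h) = h) \<and>
     (\<forall>h \<in> hedges G. endpt G h \<in> verts G) \<and>
     bij_betw (leg G) {1..card (legs G)} (legs G)"

lemma is_lgraph_iff: "is_lgraph G \<longleftrightarrow> pregraph G \<and> verts G \<noteq> {} \<and> connected_lgraph G"
  by (auto simp: is_lgraph_def pregraph_def)

lemma pregraphD:
  assumes "pregraph G"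
  shows "finite (verts G)" "finite (hedges G)"
    "h \<in> hedges G \<Longrightarrow> opp G h \<in> hedges G" "h \<in> hedges G \<Longrightarrow> opp G (opp G h) = h"
    "h \<in> hedges G \<Longrightarrow> endpt G h \<in> verts G"
    "bij_betw (leg G) {1..card (legs G)} (legs G)"
  using assms by (auto simp: pregraph_def)

text \<open>A set of edges is encoded by its half-edges, as a union of two-element orbits of the
  involution. Half-edges are what the weight formula counts, and the bijection \<open>a\<close>
  carries them along.\<close>

definition edge_closed :: "('v, 'h) lgraph \<Rightarrow> 'h set \<Rightarrow> bool" where
  "edge_closed G D \<longleftrightarrow> D \<subseteq> hedges G \<and> (\<forall>h \<in> D. opp G h \<in> D \<and> opp G h \<noteq> h)"

definition hadj :: "('v, 'h) lgraph \<Rightarrow> 'h set \<Rightarrow> ('v \<times> 'v) set" where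
  "hadj G D = {(endpt G h, endpt G (opp G h)) | h. h \<in> D}"

text \<open>The weights are compared through \<open>2 w - 2\<close>, the contribution of a vertex to \<open>2 g - 2\<close>: this is
  additive over the fibres of \<open>f\<close>, up to the contracted half-edges, and needs no Betti numbers.\<close>

definition contraction ::
  "('v \<Rightarrow> 'w) \<Rightarrow> ('h \<Rightarrow> 'k) \<Rightarrow> 'h set \<Rightarrow> ('v, 'h) lgraph \<Rightarrow> ('v \<Rightarrow> nat) \<Rightarrow>
   ('w, 'k) lgraph \<Rightarrow> ('w \<Rightarrow> nat) \<Rightarrow> bool" where
  "contraction f a D G w G' w' \<longleftrightarrow>
     pregraph G \<and> edge_closed G D \<and> f ` verts G = verts G' \<and>
     (\<forall>u \<in> verts G. \<forall>v \<in> verts G. f u = f v \<longleftrightarrow> (u, v) \<in> (hadj G D)\<^sup>*) \<and>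
     bij_betw a (hedges G - D) (hedges G') \<and>
     (\<forall>h \<in> hedges G - D. opp G' (a h) = a (opp G h) \<and> endpt G' (a h) = f (endpt G h)) \<and>
     (\<forall>i \<in> {1..card (legs G)}. a (leg G i) = leg G' i) \<and>
     (\<forall>y \<in> verts G'. 2 * int (w' y) - 2 =
        (\<Sum>u | u \<in> verts G \<and> f u = y. 2 * int (w u) - 2) + int (card {h \<in> D. f (endpt G h) = y}))"

lemma contractionD:
  assumes "contraction f a D G w G' w'"
  shows "pregraph G" "edge_closed G D" "f ` verts G = verts G'"
    "u \<in> verts G \<Longrightarrow> v \<in> verts G \<Longrightarrow> f u = f v \<longleftrightarrow> (u, v) \<in> (hadj G D)\<^sup>*"
    "bij_betw a (hedges G - D) (hedges G')"
    "h \<in> hedges G - D \<Longrightarrow> opp G' (a h) = a (opp G h)"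
    "h \<in> hedges G - D \<Longrightarrow> endpt G' (a h) = f (endpt G h)"
    "i \<in> {1..card (legs G)} \<Longrightarrow> a (leg G i) = leg G' i"
    "y \<in> verts G' \<Longrightarrow> 2 * int (w' y) - 2 =
        (\<Sum>u | u \<in> verts G \<and> f u = y. 2 * int (w u) - 2) + int (card {h \<in> D. f (endpt G h) = y})"
    "h \<in> hedges G - D \<Longrightarrow> a h \<in> hedges G'"
    "v \<in> verts G \<Longrightarrow> f v \<in> verts G'"
  using assms unfolding contraction_def by (auto simp: bij_betw_def)

lemma edge_closed_opp_notin:
  assumes "pregraph G" "edge_closed G D" "h \<in> hedges G - D"
  shows "opp G h \<in> hedges G - D"
  using assms by (metis DiffE DiffI edge_closed_def pregraphD(3) pregraphD(4))

lemma legs_notin: "edge_closed G D \<Longrightarrow> h \<in> legs G \<Longrightarrow> h \<in> hedges G - D"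
  by (auto simp: edge_closed_def legs_def)

lemma leg_in_legs: "pregraph G \<Longrightarrow> i \<in> {1..card (legs G)} \<Longrightarrow> leg G i \<in> legs G"
  by (meson bij_betwE pregraphD(6))

lemma hadj_sym:
  assumes "pregraph G" "edge_closed G D"
  shows "(u, v) \<in> hadj G D \<Longrightarrow> (v, u) \<in> hadj G D"
  using assms unfolding hadj_def edge_closed_def pregraph_def by clarsimp (metis subsetD)

lemma hadj_rtrancl_sym:
  assumes "pregraph G" "edge_closed G D"
  shows "(u, v) \<in> (hadj G D)\<^sup>* \<longleftrightarrow> (v, u) \<in> (hadj G D)\<^sup>*"
proof -
  have "sym (hadj G D)" using hadj_sym[OF assms] by (auto intro: symI)
  then show ?thesis by (meson sym_rtrancl symD)
qed

lemma hadj_mono: "D \<subseteq> D' \<Longrightarrow> (hadj G D)\<^sup>* \<subseteq> (hadj G D')\<^sup>*"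
  by (rule rtrancl_mono) (auto simp: hadj_def)

text \<open>An edge-closed set contains no leg, so legs survive. Conversely, injectivity of
  \<open>a\<close> off \<open>D\<close> makes a fixed half-edge of \<open>G'\<close> come from a
  fixed one.\<close>

lemma contraction_legs:
  assumes "contraction f a D G w G' w'"
  shows "legs G' = a ` legs G" "card (legs G') = card (legs G)"
proof -
  note c = contractionD[OF assms]
  have inj: "inj_on a (hedges G - D)" using c(5) by (auto simp: bij_betw_def)
  show eq: "legs G' = a ` legs G"
  proof (intro subset_antisym subsetI)
    fix k assume k: "k \<in> legs G'"
    then obtain h where h: "h \<in> hedges G - D" "k = a h"
      using c(5) by (auto simp: legs_def bij_betw_def)
    then have "a (opp G h) = a h" using k c(6)[OF h(1)] by (simp add: legs_def)
    then have "opp G h = h"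
      using inj h(1) edge_closed_opp_notin[OF c(1,2) h(1)] by (meson inj_onD)
    then show "k \<in> a ` legs G" using h by (auto simp: legs_def)
  next
    fix k assume "k \<in> a ` legs G"
    then obtain h where h: "h \<in> legs G" "k = a h" by auto
    have h': "h \<in> hedges G - D" using legs_notin[OF c(2) h(1)] .
    then show "k \<in> legs G'" using h c(6)[OF h'] c(10)[OF h'] by (auto simp: legs_def)
  qed
  have "inj_on a (legs G)" using inj legs_notin[OF c(2)] by (meson inj_on_subset subsetI)
  then show "card (legs G') = card (legs G)" unfolding eq by (rule card_image)
qed

text \<open>Only the source is assumed to be a graph; the target inherits the axioms because
  \<open>f\<close> and \<open>a\<close> are onto its vertices and half-edges.\<close>

lemma contraction_pregraph:
  assumes "contraction f a D G w G' w'"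
  shows "pregraph G'"
proof -
  note c = contractionD[OF assms]
  note p = pregraphD[OF c(1)]
  have H: "hedges G' = a ` (hedges G - D)" using c(5) by (simp add: bij_betw_def)
  have fin: "finite (verts G')" "finite (hedges G')" using c(3) p(1,2) H by (metis finite_imageI finite_Diff)+
  have "inj_on a (legs G)"
    using c(5) legs_notin[OF c(2)] by (meson bij_betw_def inj_on_subset subsetI)
  then have "bij_betw a (legs G) (legs G')" by (simp add: bij_betw_def contraction_legs[OF assms])
  then have "bij_betw (a \<circ> leg G) {1..card (legs G)} (legs G')"
    using p(6) bij_betw_trans by blast
  then have "bij_betw (leg G') {1..card (legs G')} (legs G')"
    unfolding contraction_legs(2)[OF assms] using c(8)
    by (subst (asm) bij_betw_cong[where g = "leg G'"]) auto
  moreover have "\<forall>h\<in>hedges G'. opp G' h \<in> hedges G' \<and> opp G' (opp G' h) = h \<and> endpt G' h \<in> verts G'"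
  proof
    fix k assume "k \<in> hedges G'"
    then obtain h where h: "h \<in> hedges G - D" "k = a h" using H by auto
    note o = edge_closed_opp_notin[OF c(1,2) h(1)]
    show "opp G' k \<in> hedges G' \<and> opp G' (opp G' k) = k \<and> endpt G' k \<in> verts G'"
      using c(6)[OF h(1)] c(6)[OF o] c(7)[OF h(1)] c(10)[OF o] h p(4)[of h] p(5)[of h] c(11) by auto
  qed
  ultimately show ?thesis using fin by (auto simp: pregraph_def)
qed

text \<open>Maps and weights are total functions of which only the values on the carriers count.
  This lets composites with chosen preimages, or a weight known to vanish, replace the given
  data.\<close>

lemma contraction_cong:
  assumes "contraction f a D G w G' w'"
    and "\<And>v. v \<in> verts G \<Longrightarrow> f2 v = f v" "\<And>h. h \<in> hedges G - D \<Longrightarrow> a2 h = a h"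
    and "\<And>v. v \<in> verts G \<Longrightarrow> w2 v = w v" "\<And>v. v \<in> verts G' \<Longrightarrow> w2' v = w' v"
  shows "contraction f2 a2 D G w2 G' w2'"
proof -
  note c = contractionD[OF assms(1)]
  note p = pregraphD[OF c(1)]
  have "{u. u \<in> verts G \<and> f2 u = y} = {u. u \<in> verts G \<and> f u = y}" for y
    using assms(2) by auto
  moreover have "{h \<in> D. f2 (endpt G h) = y} = {h \<in> D. f (endpt G h) = y}" for y
    using assms(2) p(5) c(2) by (auto simp: edge_closed_def)
  moreover have "bij_betw a2 (hedges G - D) (hedges G')"
    using c(5) assms(3) by (subst bij_betw_cong) auto
  moreover have "f2 ` verts G = verts G'" using c(3) assms(2) by (metis image_cong)
  moreover have "a2 (leg G i) = leg G' i" if "i \<in> {1..card (legs G)}" for i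
    using assms(3) c(8)[OF that] legs_notin[OF c(2) leg_in_legs[OF c(1) that]] by simp
  moreover have "opp G' (a2 h) = a2 (opp G h) \<and> endpt G' (a2 h) = f2 (endpt G h)"
    if "h \<in> hedges G - D" for h
    using c(6,7)[OF that] assms(2,3) edge_closed_opp_notin[OF c(1,2) that] that p(5) by auto
  moreover have "(\<Sum>u | u \<in> verts G \<and> f u = y. 2 * int (w2 u) - 2) =
      (\<Sum>u | u \<in> verts G \<and> f u = y. 2 * int (w u) - 2)" for y
    using assms(4) by (intro sum.cong) auto
  ultimately show ?thesis using c(1,2,4,9) assms(2,5) unfolding contraction_def by auto
qed

section \<open>Lifting, composing and factoring contractions\<close>

text \<open>A step along \<open>E\<close> lifts to \<open>G\<close>, and consecutive lifts are
  joined by paths in \<open>D\<close> because each fibre of \<open>f\<close> is one component for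
  \<open>D\<close>. Conversely, \<open>f\<close> collapses the steps in \<open>D\<close> and maps
  the others to steps in \<open>E\<close>.\<close>

lemma hadj_pull:
  assumes "contraction f a D G w G1 w1" "edge_closed G1 E"
    and "u \<in> verts G" "v \<in> verts G"
  shows "(f u, f v) \<in> (hadj G1 E)\<^sup>* \<longleftrightarrow> (u, v) \<in> (hadj G (D \<union> {h \<in> hedges G - D. a h \<in> E}))\<^sup>*"
    (is "_ \<longleftrightarrow> _ \<in> (hadj G ?D)\<^sup>*")
proof
  note c = contractionD[OF assms(1)]
  note p = pregraphD[OF c(1)]
  have comp: "(x, y) \<in> (hadj G ?D)\<^sup>*" if "x \<in> verts G" "y \<in> verts G" "f x = f y" for x y
    using c(4)[OF that(1,2)] that(3) hadj_mono[of D ?D G] by auto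
  assume "(f u, f v) \<in> (hadj G1 E)\<^sup>*"
  \<comment> \<open>The claim is made for every vertex over \<open>y\<close> at once, since the end
    of a lifted path is determined only up to the fibre.\<close>
  moreover have "(z, y) \<in> (hadj G1 E)\<^sup>* \<Longrightarrow> z = f u \<Longrightarrow> \<forall>v\<in>verts G. f v = y \<longrightarrow> (u, v) \<in> (hadj G ?D)\<^sup>*" for z y
  proof (induction rule: rtrancl_induct)
    case base
    then show ?case using comp assms(3) by auto
  next
    case (step y y')
    from step.hyps(2) obtain k where k: "k \<in> E" "y = endpt G1 k" "y' = endpt G1 (opp G1 k)"
      by (auto simp: hadj_def)
    have "k \<in> a ` (hedges G - D)"
      using k(1) assms(2) c(5) by (auto simp: edge_closed_def bij_betw_def)
    then obtain h where h: "h \<in> hedges G - D" "k = a h" by blast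
    note o = edge_closed_opp_notin[OF c(1,2) h(1)]
    have y: "y = f (endpt G h)" "y' = f (endpt G (opp G h))"
      using k h c(6)[OF h(1)] c(7)[OF h(1)] c(7)[OF o] by auto
    have ends: "endpt G h \<in> verts G" "endpt G (opp G h) \<in> verts G" using h o p(5) by auto
    have "(u, endpt G h) \<in> (hadj G ?D)\<^sup>*" using step.IH[OF step.prems] y(1) ends(1) by auto
    also have "(endpt G h, endpt G (opp G h)) \<in> hadj G ?D"
      using h k(1) by (auto simp: hadj_def)
    finally have "(u, endpt G (opp G h)) \<in> (hadj G ?D)\<^sup>*" .
    moreover have "(endpt G (opp G h), v) \<in> (hadj G ?D)\<^sup>*" if "v \<in> verts G" "f v = y'" for v
      using comp[OF ends(2) that(1)] y(2) that(2) by simp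
    ultimately show ?case by (blast intro: rtrancl_trans)
  qed
  ultimately show "(u, v) \<in> (hadj G ?D)\<^sup>*" using assms(4) by blast
next
  note c = contractionD[OF assms(1)]
  note p = pregraphD[OF c(1)]
  assume "(u, v) \<in> (hadj G ?D)\<^sup>*"
  then show "(f u, f v) \<in> (hadj G1 E)\<^sup>*"
  proof (induction rule: rtrancl_induct)
    case base
    then show ?case by simp
  next
    case (step y y')
    from step.hyps(2) obtain h where h: "h \<in> ?D" "y = endpt G h" "y' = endpt G (opp G h)"
      by (auto simp: hadj_def)
    have "(f y, f y') \<in> (hadj G1 E)\<^sup>*"
    proof (cases "h \<in> D")
      case True
      then have "(y, y') \<in> (hadj G D)\<^sup>*" using h by (auto simp: hadj_def)
      moreover have "y \<in> verts G" "y' \<in> verts G"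
        using True h p(3,5) c(2) by (auto simp: edge_closed_def)
      ultimately have "f y = f y'" using c(4) by blast
      then show ?thesis by simp
    next
      case False
      then have h': "h \<in> hedges G - D" "a h \<in> E" using h by auto
      have "(endpt G1 (a h), endpt G1 (opp G1 (a h))) \<in> hadj G1 E"
        using h' by (auto simp: hadj_def)
      then show ?thesis
        using c(6)[OF h'(1)] c(7)[OF h'(1)] c(7)[OF edge_closed_opp_notin[OF c(1,2) h'(1)]] h by auto
    qed
    then show ?case using step.IH by (rule rtrancl_trans[rotated])
  qed
qed

lemma edge_closed_pull:
  assumes "contraction f a D G w G1 w1" "edge_closed G1 E"
  shows "edge_closed G (D \<union> {h \<in> hedges G - D. a h \<in> E})"
proof -
  note c = contractionD[OF assms(1)]
  have "opp G h \<in> hedges G - D \<and> a (opp G h) \<in> E \<and> opp G h \<noteq> h" if h: "h \<in> hedges G - D" "a h \<in> E" for h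
    using edge_closed_opp_notin[OF c(1,2) h(1)] c(6)[OF h(1)] assms(2) h(2)
    by (metis edge_closed_def)
  then show ?thesis using c(2) by (auto simp: edge_closed_def)
qed

text \<open>The edges of \<open>E\<close> that survive \<open>D\<close> are the ones to contract
  next; lifting them back recovers \<open>E\<close>, which matches the shape of
  \<open>contraction_comp_iff\<close>.\<close>

lemma edge_closed_push:
  assumes "contraction f a D G w G1 w1" "edge_closed G E" "D \<subseteq> E"
  shows "edge_closed G1 (a ` (E - D))"
    and "D \<union> {h \<in> hedges G - D. a h \<in> a ` (E - D)} = E"
proof -
  note c = contractionD[OF assms(1)]
  have inj: "inj_on a (hedges G - D)" using c(5) by (auto simp: bij_betw_def)
  have E: "E \<subseteq> hedges G" using assms(2) by (auto simp: edge_closed_def)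
  have "opp G1 (a h) \<in> a ` (E - D) \<and> opp G1 (a h) \<noteq> a h \<and> a h \<in> hedges G1" if h: "h \<in> E - D" for h
  proof -
    have h': "h \<in> hedges G - D" using h E by auto
    note o = edge_closed_opp_notin[OF c(1,2) h']
    have "opp G h \<noteq> h" "opp G h \<in> E" using h assms(2) by (auto simp: edge_closed_def)
    then show ?thesis using c(6)[OF h'] c(10)[OF h'] inj_onD[OF inj _ o h'] o by auto
  qed
  then show "edge_closed G1 (a ` (E - D))" by (auto simp: edge_closed_def)
  show "D \<union> {h \<in> hedges G - D. a h \<in> a ` (E - D)} = E"
    using assms(3) E inj by (auto dest: inj_onD)
qed

text \<open>Since \<open>f\<close> and \<open>a\<close> are surjective, each clause for the second
  contraction is equivalent to the same clause for the composite. The forward direction gives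
  composition, the backward one factorization.\<close>

lemma contraction_comp_iff:
  fixes G :: "('v, 'h) lgraph" and G1 :: "('w, 'k) lgraph" and G2 :: "('x, 'l) lgraph"
  assumes 1: "contraction f a D G w G1 w1" and E: "edge_closed G1 E"
  shows "contraction f' a' E G1 w1 G2 w2 \<longleftrightarrow>
    contraction (f' \<circ> f) (a' \<circ> a) (D \<union> {h \<in> hedges G - D. a h \<in> E}) G w G2 w2"
proof -
  note c = contractionD[OF 1]
  note p = pregraphD[OF c(1)]
  let ?P = "{h \<in> hedges G - D. a h \<in> E}"
  let ?D = "D \<union> ?P"
  have p1: "pregraph G1" using contraction_pregraph[OF 1] .
  have inj: "inj_on a (hedges G - D)" and H1: "hedges G1 = a ` (hedges G - D)"
    using c(5) by (auto simp: bij_betw_def)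
  have EH: "E \<subseteq> hedges G1" using E by (auto simp: edge_closed_def)
  have HE: "hedges G1 - E = a ` (hedges G - ?D)" using H1 by auto
  have bij: "bij_betw a (hedges G - ?D) (hedges G1 - E)"
    unfolding HE bij_betw_def using inj by (auto intro: inj_on_subset)
  have aP: "a ` ?P = E" using H1 EH by auto
  have injP: "inj_on a ?P" using inj by (rule inj_on_subset) auto
  have "f' ` verts G1 = verts G2 \<longleftrightarrow> (f' \<circ> f) ` verts G = verts G2"
    by (simp flip: c(3) add: image_comp)
  moreover have "(\<forall>u\<in>verts G1. \<forall>v\<in>verts G1. (f' u = f' v) = ((u, v) \<in> (hadj G1 E)\<^sup>*)) \<longleftrightarrow>
      (\<forall>u\<in>verts G. \<forall>v\<in>verts G. ((f' \<circ> f) u = (f' \<circ> f) v) = ((u, v) \<in> (hadj G ?D)\<^sup>*))"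
    unfolding c(3)[symmetric] using hadj_pull[OF 1 E] by auto
  moreover have "bij_betw a' (hedges G1 - E) (hedges G2) \<longleftrightarrow> bij_betw (a' \<circ> a) (hedges G - ?D) (hedges G2)"
    using bij by (rule bij_betw_comp_iff)
  moreover have "(\<forall>h\<in>hedges G1 - E. opp G2 (a' h) = a' (opp G1 h) \<and> endpt G2 (a' h) = f' (endpt G1 h)) \<longleftrightarrow>
      (\<forall>h\<in>hedges G - ?D. opp G2 ((a' \<circ> a) h) = (a' \<circ> a) (opp G h) \<and>
                          endpt G2 ((a' \<circ> a) h) = (f' \<circ> f) (endpt G h))"
    unfolding HE using c(6,7) by auto
  moreover have "(\<forall>i\<in>{1..card (legs G1)}. a' (leg G1 i) = leg G2 i) \<longleftrightarrow>
      (\<forall>i\<in>{1..card (legs G)}. (a' \<circ> a) (leg G i) = leg G2 i)"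
    unfolding contraction_legs(2)[OF 1] using c(8) by auto
  \<comment> \<open>Weight clause: vertices and half-edges of \<open>D\<close> are regrouped by
    their image in \<open>G1\<close>, and \<open>E\<close> is counted through its lifts
    \<open>?P\<close>.\<close>
  moreover have "(\<Sum>u | u \<in> verts G1 \<and> f' u = y. 2 * int (w1 u) - 2) + int (card {h \<in> E. f' (endpt G1 h) = y}) =
      (\<Sum>u | u \<in> verts G \<and> (f' \<circ> f) u = y. 2 * int (w u) - 2) +
       int (card {h \<in> ?D. (f' \<circ> f) (endpt G h) = y})" for y
  proof -
    have fin1: "finite {u. u \<in> verts G1 \<and> f' u = y}" using pregraphD(1)[OF p1] by auto
    have finD: "finite D" "finite ?P" using c(2) p(2) by (auto simp: edge_closed_def intro: finite_subset)
    have "(\<Sum>u | u \<in> verts G1 \<and> f' u = y. 2 * int (w1 u) - 2) =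
      (\<Sum>x | x \<in> verts G1 \<and> f' x = y. (\<Sum>u | u \<in> verts G \<and> f u = x. 2 * int (w u) - 2)
         + int (card {h \<in> D. f (endpt G h) = x}))"
      using c(9) by (intro sum.cong) auto
    also have "\<dots> = (\<Sum>x | x \<in> verts G1 \<and> f' x = y. \<Sum>u | u \<in> verts G \<and> f u = x. 2 * int (w u) - 2)
       + (\<Sum>x | x \<in> verts G1 \<and> f' x = y. int (card {h \<in> D. f (endpt G h) = x}))"
      by (rule sum.distrib)
    finally have "(\<Sum>u | u \<in> verts G1 \<and> f' u = y. 2 * int (w1 u) - 2) = \<dots>" .
    moreover have "(\<Sum>x | x \<in> verts G1 \<and> f' x = y. \<Sum>u | u \<in> verts G \<and> f u = x. 2 * int (w u) - 2) =
       (\<Sum>u | u \<in> verts G \<and> (f' \<circ> f) u = y. 2 * int (w u) - 2)"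
    proof -
      have "(\<Sum>x | x \<in> verts G1 \<and> f' x = y. \<Sum>u | u \<in> verts G \<and> f u = x. 2 * int (w u) - 2) =
        (\<Sum>x | x \<in> verts G1 \<and> f' x = y.
           \<Sum>u | u \<in> {u. u \<in> verts G \<and> (f' \<circ> f) u = y} \<and> f u = x. 2 * int (w u) - 2)"
        by (intro sum.cong) auto
      also have "\<dots> = (\<Sum>u | u \<in> verts G \<and> (f' \<circ> f) u = y. 2 * int (w u) - 2)"
        using p(1) fin1 c(11) by (intro sum.group) auto
      finally show ?thesis .
    qed
    moreover have "(\<Sum>x | x \<in> verts G1 \<and> f' x = y. int (card {h \<in> D. f (endpt G h) = x})) =
      int (card {h \<in> D. (f' \<circ> f) (endpt G h) = y})"
    proof -
      have "(\<Sum>x | x \<in> verts G1 \<and> f' x = y. card {h \<in> D. f (endpt G h) = x}) =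
        (\<Sum>x | x \<in> verts G1 \<and> f' x = y.
           \<Sum>h | h \<in> {h \<in> D. (f' \<circ> f) (endpt G h) = y} \<and> f (endpt G h) = x. 1)"
        by (intro sum.cong) (auto intro!: arg_cong[where f = card])
      also have "\<dots> = (\<Sum>h \<in> {h \<in> D. (f' \<circ> f) (endpt G h) = y}. 1)"
        using finD fin1 c(2,11) p(5) by (intro sum.group) (auto simp: edge_closed_def)
      finally have "(\<Sum>x | x \<in> verts G1 \<and> f' x = y. card {h \<in> D. f (endpt G h) = x}) =
        card {h \<in> D. (f' \<circ> f) (endpt G h) = y}" by simp
      then show ?thesis by (simp only: flip: of_nat_sum)
    qed
    moreover have "{h \<in> E. f' (endpt G1 h) = y} = a ` {h \<in> ?P. (f' \<circ> f) (endpt G h) = y}"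
      (is "?L = a ` ?R")
    proof (intro subset_antisym subsetI)
      fix k assume k: "k \<in> ?L"
      then have "k \<in> a ` ?P" by (simp only: aP mem_Collect_eq)
      then obtain h where h: "h \<in> ?P" "k = a h" by blast
      then have "h \<in> ?R" using k c(7)[of h] by simp
      then show "k \<in> a ` ?R" using h(2) by blast
    next
      fix k assume "k \<in> a ` ?R"
      then obtain h where h: "h \<in> ?R" "k = a h" by blast
      then show "k \<in> ?L" using c(7)[of h] by simp
    qed
    moreover have "card (a ` {h \<in> ?P. (f' \<circ> f) (endpt G h) = y}) = card {h \<in> ?P. (f' \<circ> f) (endpt G h) = y}"
      using injP by (intro card_image) (auto intro: inj_on_subset)
    moreover have "{h \<in> ?D. (f' \<circ> f) (endpt G h) = y} =
      {h \<in> D. (f' \<circ> f) (endpt G h) = y} \<union> {h \<in> ?P. (f' \<circ> f) (endpt G h) = y}" by auto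
    moreover have "card ({h \<in> D. (f' \<circ> f) (endpt G h) = y} \<union> {h \<in> ?P. (f' \<circ> f) (endpt G h) = y}) =
        card {h \<in> D. (f' \<circ> f) (endpt G h) = y} + card {h \<in> ?P. (f' \<circ> f) (endpt G h) = y}"
      using finD p(2) by (intro card_Un_disjoint) auto
    ultimately show ?thesis by (simp only: of_nat_add add.assoc)
  qed
  ultimately show ?thesis
    unfolding contraction_def using c(1) p1 E edge_closed_pull[OF 1 E]
    by (simp only: simp_thms)
qed

lemma contraction_comp:
  assumes "contraction f a D G w G1 w1" "contraction f' a' E G1 w1 G2 w2"
  shows "contraction (f' \<circ> f) (a' \<circ> a) (D \<union> {h \<in> hedges G - D. a h \<in> E}) G w G2 w2"
  using contraction_comp_iff[OF assms(1) contractionD(2)[OF assms(2)]] assms(2) by blast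

text \<open>The candidates invert \<open>f\<close> and \<open>a\<close> by choice and then apply
  \<open>f2\<close> and \<open>a2\<close>. Their composites with \<open>f\<close> and
  \<open>a\<close> agree with the given contraction of \<open>E\<close>, so the backward direction
  of \<open>contraction_comp_iff\<close> applies.\<close>

lemma contraction_factor:
  assumes 1: "contraction f a D G w G1 w1" and 2: "contraction f2 a2 E G w G2 w2" and "D \<subseteq> E"
  obtains f' a' where "contraction f' a' (a ` (E - D)) G1 w1 G2 w2"
    "\<And>h. h \<in> hedges G - E \<Longrightarrow> a' (a h) = a2 h"
proof -
  note c = contractionD[OF 1] and d = contractionD[OF 2]
  define f' where "f' = f2 \<circ> inv_into (verts G) f"
  define a' where "a' = a2 \<circ> inv_into (hedges G - D) a"
  have inj: "inj_on a (hedges G - D)" using c(5) by (auto simp: bij_betw_def)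
  have a': "a' (a h) = a2 h" if "h \<in> hedges G - D" for h
    using inj that by (simp add: a'_def)
  have f': "f' (f v) = f2 v" if "v \<in> verts G" for v
  proof -
    \<comment> \<open>The chosen preimage need not be \<open>v\<close>, but both lie in one
      component for \<open>D\<close>, hence for \<open>E\<close>.\<close>
    let ?u = "inv_into (verts G) f (f v)"
    have u: "?u \<in> verts G" "f ?u = f v" using that by (auto intro: inv_into_into f_inv_into_f)
    then have "(?u, v) \<in> (hadj G E)\<^sup>*" using c(4)[OF u(1) that] hadj_mono[OF assms(3)] by auto
    then show ?thesis using d(4)[OF u(1) that] by (simp add: f'_def)
  qed
  note push = edge_closed_push[OF 1 d(2) assms(3)]
  have "contraction (f' \<circ> f) (a' \<circ> a) E G w G2 w2"
    using contraction_cong[OF 2, of "f' \<circ> f" "a' \<circ> a" w w2] f' a' assms(3) by auto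
  then have "contraction f' a' (a ` (E - D)) G1 w1 G2 w2"
    using contraction_comp_iff[OF 1 push(1), of f' a' G2 w2] push(2) by simp
  then show ?thesis using that a' assms(3) by blast
qed

section \<open>Genus, stability and weights under contraction\<close>

lemma involution_orbits_card:
  assumes "finite H" "\<And>h. h \<in> H \<Longrightarrow> i h \<in> H \<and> i h \<noteq> h \<and> i (i h) = h"
  shows "card H = 2 * card {{h, i h} | h. h \<in> H}"
proof -
  let ?E = "{{h, i h} | h. h \<in> H}"
  have "?E = (\<lambda>h. {h, i h}) ` H" by auto
  then have fin: "finite ?E" using assms(1) by simp
  have H: "H = \<Union>?E" using assms(2) by blast
  have orbit: "e = {x, i x}" if "e \<in> ?E" "x \<in> e" for e x
    using that assms(2) by auto
  have "card (\<Union>?E) = (\<Sum>e\<in>?E. card e)"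
  proof (rule card_Union_disjoint)
    show "disjoint ?E"
    proof (rule pairwiseI)
      fix e e' assume e: "e \<in> ?E" "e' \<in> ?E" and "e \<noteq> e'"
      have "e = e'" if "x \<in> e" "x \<in> e'" for x
        by (rule trans[OF orbit[OF e(1) that(1)] orbit[OF e(2) that(2), symmetric]])
      then show "disjnt e e'" using \<open>e \<noteq> e'\<close> by (meson disjnt_iff)
    qed
  qed (auto intro: finite_subset[OF _ assms(1)])
  also have "\<dots> = (\<Sum>e\<in>?E. 2)"
  proof (rule sum.cong)
    fix e assume "e \<in> ?E"
    then obtain h where "e = {h, i h}" "h \<in> H" by auto
    then show "card e = 2" using assms(2)[of h] by auto
  qed simp
  finally have "card (\<Union>?E) = 2 * card ?E" by simp
  then show ?thesis by (rule trans[OF arg_cong[OF H, of card]])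
qed

lemma card_edges:
  assumes "pregraph G"
  shows "card (hedges G) = 2 * card (edges G) + card (legs G)"
proof -
  note p = pregraphD[OF assms]
  let ?H = "{h \<in> hedges G. opp G h \<noteq> h}"
  have "card ?H = 2 * card {{h, opp G h} | h. h \<in> ?H}"
    using p by (intro involution_orbits_card) auto
  moreover have "{{h, opp G h} | h. h \<in> ?H} = edges G" by (auto simp: edges_def)
  moreover have "hedges G = ?H \<union> legs G" "?H \<inter> legs G = {}" by (auto simp: legs_def)
  then have "card (hedges G) = card ?H + card (legs G)"
    using p(2) by (metis (no_types, lifting) card_Un_disjoint finite_Un)
  ultimately show ?thesis by simp
qed

text \<open>Orient a spanning tree of the component towards \<open>r\<close>: each vertex other than \<open>r\<close> owns the two
  half-edges of the edge to its parent.\<close>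

lemma component_card_le:
  fixes G :: "('v, 'h) lgraph"
  assumes G: "pregraph G" and D: "edge_closed G D" and r: "r \<in> verts G"
    and X: "X = {u \<in> verts G. (r, u) \<in> (hadj G D)\<^sup>*}"
  shows "2 * card X \<le> card {h \<in> D. endpt G h \<in> X} + 2"
proof -
  note p = pregraphD[OF G]
  let ?R = "hadj G D"
  let ?DX = "{h \<in> D. endpt G h \<in> X}"
  \<comment> \<open>The graph distance from \<open>r\<close> along \<open>D\<close>.\<close>
  define d where "d v = (LEAST n. (r, v) \<in> ?R ^^ n)" for v
  have DH: "D \<subseteq> hedges G" using D by (auto simp: edge_closed_def)
  \<comment> \<open>The last edge of a shortest path from \<open>r\<close> to \<open>v\<close>, read
    from \<open>v\<close>, leads one step closer to \<open>r\<close>.\<close>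
  have parent: "\<exists>h. h \<in> D \<and> endpt G h = v \<and> endpt G (opp G h) \<in> X \<and> d v = Suc (d (endpt G (opp G h)))"
    if v: "v \<in> X" "v \<noteq> r" for v
  proof -
    have "\<exists>n. (r, v) \<in> ?R ^^ n" using v X by (simp add: rtrancl_power)
    then have n: "(r, v) \<in> ?R ^^ d v" unfolding d_def by (rule LeastI_ex)
    then have "d v \<noteq> 0" using v by (intro notI) simp
    then obtain m where m: "d v = Suc m" using not0_implies_Suc by blast
    then obtain u where u: "(r, u) \<in> ?R ^^ m" "(u, v) \<in> ?R" using n by auto
    from hadj_sym[OF G D u(2)] obtain h where h: "h \<in> D" "v = endpt G h" "u = endpt G (opp G h)"
      by (auto simp: hadj_def)
    have "u \<in> X" using u(1) h DH p(3,5) X relpow_imp_rtrancl by fastforce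
    moreover have "d u \<le> m" unfolding d_def using u(1) by (rule Least_le)
    moreover have "(r, u) \<in> ?R ^^ d u" unfolding d_def using u(1) by (rule LeastI)
    then have "(r, v) \<in> ?R ^^ Suc (d u)" using u(2) by auto
    then have "d v \<le> Suc (d u)" unfolding d_def by (rule Least_le)
    ultimately show ?thesis using h m by (intro exI[of _ h]) auto
  qed
  then obtain par where par: "\<And>v. v \<in> X - {r} \<Longrightarrow> par v \<in> D \<and> endpt G (par v) = v \<and>
      endpt G (opp G (par v)) \<in> X \<and> d v = Suc (d (endpt G (opp G (par v))))"
    by (metis DiffE insertI1)
  have opp_opp: "opp G (opp G h) = h" if "h \<in> D" for h using that DH p(4) by auto
  have fin: "finite X" "finite ?DX" using X p(1) finite_subset[OF DH p(2)] by auto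
  have injp: "inj_on par (X - {r})" using par by (metis inj_onI)
  have injq: "inj_on (opp G \<circ> par) (X - {r})"
    using par opp_opp by (intro inj_onI) (metis comp_apply)
  \<comment> \<open>If two vertices owned the same edge from its two ends, each would be strictly
    farther from \<open>r\<close> than the other.\<close>
  have disj: "par ` (X - {r}) \<inter> (opp G \<circ> par) ` (X - {r}) = {}"
  proof (rule ccontr)
    assume "\<not> ?thesis"
    then obtain u v where uv: "u \<in> X - {r}" "v \<in> X - {r}" "par v = opp G (par u)" by auto
    have "opp G (par v) = par u" using uv opp_opp par by auto
    moreover have "endpt G (par u) = u" "endpt G (par v) = v"
      "d u = Suc (d (endpt G (opp G (par u))))" "d v = Suc (d (endpt G (opp G (par v))))"
      using par uv(1,2) by blast+
    ultimately have "d v = Suc (d u)" "d u = Suc (d v)" using uv(3) by (simp_all only:)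
    then show False by simp
  qed
  have sub: "par ` (X - {r}) \<union> (opp G \<circ> par) ` (X - {r}) \<subseteq> ?DX"
    using par D by (auto simp: edge_closed_def)
  have rX: "r \<in> X" using r X by auto
  have "card (par ` (X - {r}) \<union> (opp G \<circ> par) ` (X - {r})) = 2 * (card X - 1)"
    using fin disj rX by (simp add: card_Un_disjoint card_image[OF injp] card_image[OF injq, unfolded comp_def])
  then have "2 * (card X - 1) \<le> card ?DX" using card_mono[OF fin(2) sub] by simp
  then show ?thesis by linarith
qed

lemma inner_edge_closed:
  assumes "pregraph G"
  shows "edge_closed G {h \<in> hedges G. opp G h \<noteq> h}"
  using pregraphD(3,4)[OF assms] by (auto simp: edge_closed_def)

lemma adj_edges: "pregraph G \<Longrightarrow> adj G (edges G) = hadj G {h \<in> hedges G. opp G h \<noteq> h}"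
proof -
  assume G: "pregraph G"
  have "{h, opp G h} \<in> edges G \<longleftrightarrow> opp G h \<noteq> h" if h: "h \<in> hedges G" for h
  proof
    assume "{h, opp G h} \<in> edges G"
    then obtain k where "{h, opp G h} = {k, opp G k}" "opp G k \<noteq> k" by (auto simp: edges_def)
    then show "opp G h \<noteq> h" by (metis doubleton_eq_iff insert_absorb2)
  qed (use h in \<open>auto simp: edges_def\<close>)
  then show ?thesis by (auto simp: adj_def hadj_def)
qed

lemma connected_lgraph_iff_hadj:
  assumes "pregraph G"
  shows "connected_lgraph G \<longleftrightarrow>
    (\<forall>u \<in> verts G. \<forall>v \<in> verts G. (u, v) \<in> (hadj G {h \<in> hedges G. opp G h \<noteq> h})\<^sup>*)"
  unfolding connected_lgraph_def adj_edges[OF assms] ..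

text \<open>This is the Euler characteristic, with edges counted by half-edges. The spanning tree
  bound, applied to the whole connected graph, shows that the subtraction in \<open>betti1\<close>
  does not truncate.\<close>

lemma genus_eq:
  assumes "is_lgraph G"
  shows "2 * int (genus G w) - 2 + int (card (legs G)) =
    (\<Sum>v\<in>verts G. 2 * int (w v) - 2) + int (card (hedges G))"
proof -
  have G: "pregraph G" "verts G \<noteq> {}" "connected_lgraph G" using assms by (auto simp: is_lgraph_iff)
  note p = pregraphD[OF G(1)]
  let ?D = "{h \<in> hedges G. opp G h \<noteq> h}"
  obtain r where r: "r \<in> verts G" using G(2) by auto
  have X: "verts G = {u \<in> verts G. (r, u) \<in> (hadj G ?D)\<^sup>*}"
    using G(3) r by (auto simp: connected_lgraph_iff_hadj[OF G(1)])
  have "2 * card (verts G) \<le> card {h \<in> ?D. endpt G h \<in> verts G} + 2"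
    by (rule component_card_le[OF G(1) inner_edge_closed[OF G(1)] r X])
  also have "{h \<in> ?D. endpt G h \<in> verts G} = hedges G - legs G"
    using p(5) by (auto simp: legs_def)
  also have "card \<dots> = card (hedges G) - card (legs G)"
    using p(2) by (intro card_Diff_subset) (auto simp: legs_def)
  finally have "card (verts G) \<le> card (edges G) + 1"
    using card_edges[OF G(1)] by simp
  then have "int (betti1 G) = int (card (edges G)) + 1 - int (card (verts G))"
    by (simp add: betti1_def)
  then show ?thesis using card_edges[OF G(1)]
    by (simp add: genus_def sum_subtractf sum_distrib_left)
qed

text \<open>The half-edges of \<open>G\<close> that are not legs are those of \<open>D\<close> and
  those lying over half-edges of \<open>G'\<close> that are not legs, so \<open>hadj_pull\<close>
  compares connectivity above and below.\<close>

lemma contraction_connected_iff: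
  assumes "contraction f a D G w G' w'"
  shows "connected_lgraph G \<longleftrightarrow> connected_lgraph G'"
proof -
  note c = contractionD[OF assms]
  note p' = contraction_pregraph[OF assms]
  have inj: "inj_on a (hedges G - D)" using c(5) by (auto simp: bij_betw_def)
  have "D \<union> {h \<in> hedges G - D. a h \<in> {h \<in> hedges G'. opp G' h \<noteq> h}} = {h \<in> hedges G. opp G h \<noteq> h}"
  proof -
    have "opp G' (a h) = a h \<longleftrightarrow> opp G h = h" if "h \<in> hedges G - D" for h
      using c(6)[OF that] edge_closed_opp_notin[OF c(1,2) that] inj that by (auto dest: inj_onD)
    then show ?thesis using c(2,10) by (auto simp: edge_closed_def)
  qed
  then have "(f u, f v) \<in> (hadj G' {h \<in> hedges G'. opp G' h \<noteq> h})\<^sup>* \<longleftrightarrow>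
      (u, v) \<in> (hadj G {h \<in> hedges G. opp G h \<noteq> h})\<^sup>*" if "u \<in> verts G" "v \<in> verts G" for u v
    using hadj_pull[OF assms inner_edge_closed[OF p'] that] by simp
  then show ?thesis
    unfolding connected_lgraph_iff_hadj[OF c(1)] connected_lgraph_iff_hadj[OF p'] c(3)[symmetric]
    by simp
qed

lemma contraction_is_lgraph_iff:
  assumes "contraction f a D G w G' w'"
  shows "is_lgraph G \<longleftrightarrow> is_lgraph G'"
  using contraction_connected_iff[OF assms] contraction_pregraph[OF assms] contractionD(1,3)[OF assms]
  by (auto simp: is_lgraph_iff)

text \<open>Summing the weight clause over all vertices adds \<open>card D\<close> to the sum of the
  terms \<open>2 w - 2\<close>, while the number of half-edges drops by \<open>card D\<close>; the
  two changes cancel in \<open>genus_eq\<close>.\<close>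

lemma contraction_genus:
  assumes "contraction f a D G w G' w'" "is_lgraph G"
  shows "genus G' w' = genus G w"
proof -
  note c = contractionD[OF assms(1)]
  note p = pregraphD[OF c(1)]
  have G': "is_lgraph G'" using contraction_is_lgraph_iff[OF assms(1)] assms(2) by simp
  have finV: "finite (verts G')" using pregraphD(1)[OF contraction_pregraph[OF assms(1)]] .
  have DH: "D \<subseteq> hedges G" using c(2) by (auto simp: edge_closed_def)
  have finD: "finite D" using finite_subset[OF DH p(2)] .
  have "(\<Sum>y\<in>verts G'. 2 * int (w' y) - 2) =
    (\<Sum>y\<in>verts G'. (\<Sum>u | u \<in> verts G \<and> f u = y. 2 * int (w u) - 2) + int (card {h \<in> D. f (endpt G h) = y}))"
    using c(9) by (intro sum.cong) auto
  also have "\<dots> = (\<Sum>y\<in>verts G'. \<Sum>u | u \<in> verts G \<and> f u = y. 2 * int (w u) - 2) +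
      int (\<Sum>y\<in>verts G'. \<Sum>h | h \<in> D \<and> f (endpt G h) = y. 1)"
    by (simp add: sum.distrib)
  also have "(\<Sum>y\<in>verts G'. \<Sum>u | u \<in> verts G \<and> f u = y. 2 * int (w u) - 2) =
     (\<Sum>u\<in>verts G. 2 * int (w u) - 2)"
    using p(1) finV c(3) by (intro sum.group) auto
  also have "(\<Sum>y\<in>verts G'. \<Sum>h | h \<in> D \<and> f (endpt G h) = y. 1) = (\<Sum>h\<in>D. 1)"
    using finD finV c(11) p(5) DH by (intro sum.group) auto
  finally have sum: "(\<Sum>y\<in>verts G'. 2 * int (w' y) - 2) = (\<Sum>u\<in>verts G. 2 * int (w u) - 2) + int (card D)"
    by simp
  have "card (hedges G') = card (hedges G - D)" using bij_betw_same_card[OF c(5)] by simp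
  then have "int (card (hedges G')) = int (card (hedges G)) - int (card D)"
    using card_Diff_subset[OF finD DH] card_mono[OF p(2) DH] by simp
  then show ?thesis
    using genus_eq[OF assms(2), of w] genus_eq[OF G', of w'] sum contraction_legs(2)[OF assms(1)]
    by simp
qed

text \<open>Both stability conditions become one linear inequality, saying that the valence plus
  \<open>2 w - 2\<close> is at least 1. In this form it can be summed over the fibres of a
  contraction.\<close>

lemma stable_iff: "stable G w \<longleftrightarrow> (\<forall>v\<in>verts G. 3 \<le> valence G v + 2 * w v)"
proof -
  have "((k = 0 \<longrightarrow> 3 \<le> c) \<and> (k = 1 \<longrightarrow> 1 \<le> c)) \<longleftrightarrow> 3 \<le> c + 2 * k" for c k :: nat
    by (cases "k = 0"; cases "k = 1") auto
  then show ?thesis unfolding stable_def by simp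
qed

text \<open>A half-edge at a vertex of the fibre is either contracted or survives as a half-edge at
  \<open>y\<close>.\<close>

lemma contraction_valence:
  assumes "contraction f a D G w G' w'" "y \<in> verts G'"
  shows "valence G' y + card {h \<in> D. f (endpt G h) = y} = (\<Sum>u | u \<in> verts G \<and> f u = y. valence G u)"
proof -
  note c = contractionD[OF assms(1)]
  note p = pregraphD[OF c(1)]
  have DH: "D \<subseteq> hedges G" using c(2) by (auto simp: edge_closed_def)
  have inj: "inj_on a (hedges G - D)" using c(5) by (auto simp: bij_betw_def)
  have "{k \<in> hedges G'. endpt G' k = y} = a ` {h \<in> hedges G - D. f (endpt G h) = y}"
    using c(5,7) unfolding bij_betw_def by (auto 0 3)
  then have "valence G' y = card {h \<in> hedges G - D. f (endpt G h) = y}"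
    unfolding valence_def using inj by (auto intro!: card_image intro: inj_on_subset)
  also have "\<dots> + card {h \<in> D. f (endpt G h) = y} =
     card ({h \<in> hedges G - D. f (endpt G h) = y} \<union> {h \<in> D. f (endpt G h) = y})"
    using p(2) finite_subset[OF DH p(2)] by (subst card_Un_disjoint) auto
  also have "{h \<in> hedges G - D. f (endpt G h) = y} \<union> {h \<in> D. f (endpt G h) = y} =
     {h \<in> hedges G. f (endpt G h) = y}" using DH by auto
  also have "card \<dots> = (\<Sum>h | h \<in> hedges G \<and> f (endpt G h) = y. 1)" by simp
  also have "\<dots> = (\<Sum>u | u \<in> verts G \<and> f u = y.
      \<Sum>h | h \<in> {h \<in> hedges G. f (endpt G h) = y} \<and> endpt G h = u. 1)"
    using p by (intro sum.group[symmetric]) auto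
  also have "\<dots> = (\<Sum>u | u \<in> verts G \<and> f u = y. valence G u)"
    unfolding valence_def by (intro sum.cong) (auto intro!: arg_cong[where f = card])
  finally show ?thesis .
qed

text \<open>The inequality of \<open>stable_iff\<close> is summed over a nonempty fibre. The
  contracted half-edges leave the valence and enter the weight term, so they cancel.\<close>

lemma contraction_stable:
  assumes "contraction f a D G w G' w'" "stable G w"
  shows "stable G' w'"
  unfolding stable_iff
proof
  fix y assume y: "y \<in> verts G'"
  note c = contractionD[OF assms(1)]
  have "y \<in> f ` verts G" using y c(3) by simp
  then obtain u0 where u0: "u0 \<in> verts G" "f u0 = y" by blast
  let ?U = "{u \<in> verts G. f u = y}"
  have fin: "finite ?U" using pregraphD(1)[OF c(1)] by auto
  have "1 \<le> int (card ?U)" using u0 fin by (simp add: Suc_le_eq card_gt_0_iff) blast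
  also have "\<dots> = (\<Sum>u\<in>?U. 1)" by simp
  also have "\<dots> \<le> (\<Sum>u\<in>?U. int (valence G u) + (2 * int (w u) - 2))"
    using assms(2) unfolding stable_iff by (intro sum_mono) force
  also have "\<dots> = int (\<Sum>u\<in>?U. valence G u) + (\<Sum>u\<in>?U. 2 * int (w u) - 2)"
    by (simp add: sum.distrib)
  also have "\<dots> = int (valence G' y) + (2 * int (w' y) - 2)"
    unfolding contraction_valence[OF assms(1) y, symmetric] c(9)[OF y] by simp
  finally show "3 \<le> valence G' y + 2 * w' y" by simp
qed

text \<open>A vertex of weight zero has a fibre that is a tree of vertices of weight zero: the
  weight clause expresses the total weight of the fibre through its numbers of vertices and
  contracted half-edges, and \<open>component_card_le\<close> bounds it by zero.\<close>

lemma contraction_weight_zero: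
  assumes "contraction f a D G w G' w'" "u \<in> verts G" "w' (f u) = 0"
  shows "w u = 0"
proof -
  note c = contractionD[OF assms(1)]
  note p = pregraphD[OF c(1)]
  let ?X = "{v \<in> verts G. f v = f u}"
  have X: "?X = {v \<in> verts G. (u, v) \<in> (hadj G D)\<^sup>*}" 
    using c(4)[OF assms(2)] by (metis (lifting))
  have fin: "finite ?X" using p(1) by auto
  have "{h \<in> D. f (endpt G h) = f u} = {h \<in> D. endpt G h \<in> ?X}"
    using c(2) p(5) by (auto simp: edge_closed_def)
  then have "2 * int (card ?X) \<le> int (card {h \<in> D. f (endpt G h) = f u}) + 2"
    using component_card_le[OF c(1,2) assms(2) X] by simp
  moreover have "- 2 = (\<Sum>v\<in>?X. 2 * int (w v) - 2) + int (card {h \<in> D. f (endpt G h) = f u})"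
    using c(9)[OF c(11)[OF assms(2)]] assms(3) by simp
  ultimately have "(\<Sum>v\<in>?X. int (w v)) \<le> 0"
    by (simp add: sum_subtractf flip: sum_distrib_left)
  then have "(\<Sum>v\<in>?X. w v) = 0" by (metis of_nat_le_0_iff of_nat_sum)
  then show ?thesis using fin assms(2) by simp
qed

section \<open>Curves at points of the closed cells\<close>

text \<open>Translates sets of edges, as used by \<open>contract\<close>, into sets of half-edges,
  as used by \<open>contraction\<close>.\<close>

definition hset :: "('v, 'h) lgraph \<Rightarrow> 'h set set \<Rightarrow> 'h set" where
  "hset G S = {h \<in> hedges G. {h, opp G h} \<in> S}"

lemma adj_eq_hadj: "adj G S = hadj G (hset G S)"
  by (auto simp: adj_def hadj_def hset_def)

lemma ball_edges: "(\<forall>e\<in>edges G. P e) \<longleftrightarrow> (\<forall>h\<in>hedges G. opp G h \<noteq> h \<longrightarrow> P {h, opp G h})"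
  by (auto simp: edges_def)

lemma pair_in_edges_iff:
  "h \<in> hedges G \<Longrightarrow> {h, opp G h} \<in> edges G \<longleftrightarrow> opp G h \<noteq> h"
  by (auto simp: edges_def doubleton_eq_iff)

lemma hset_edge_closed:
  assumes "pregraph G" "S \<subseteq> edges G"
  shows "edge_closed G (hset G S)"
proof -
  have "opp G h \<in> hset G S \<and> opp G h \<noteq> h" if "h \<in> hset G S" for h
    using that assms(2) pregraphD(3,4)[OF assms(1)] pair_in_edges_iff[of h G]
    by (auto simp: hset_def insert_commute)
  then show ?thesis by (auto simp: edge_closed_def hset_def)
qed

text \<open>The concrete weighted contraction is an instance of the relation. The substance is the
  weight clause: \<open>betti1\<close> of a fibre is not truncated, by
  \<open>component_card_le\<close>, and its edges are half of the contracted half-edges over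
  it.\<close>

lemma contract_contraction:
  assumes G: "pregraph G" and S: "S \<subseteq> edges G"
  shows "contraction (contr_map G S) (\<lambda>h. h) (hset G S) G w (contract G S) (contract_weight G w S)"
proof -
  note p = pregraphD[OF G]
  let ?D = "hset G S" and ?s = "contr_map G S"
  note D = hset_edge_closed[OF G S]
  have s: "?s v = {u \<in> verts G. (v, u) \<in> (hadj G ?D)\<^sup>*}" for v
    by (simp add: contr_map_def adj_eq_hadj)
  have s_eq: "?s u = ?s v \<longleftrightarrow> (u, v) \<in> (hadj G ?D)\<^sup>*" if "u \<in> verts G" "v \<in> verts G" for u v
  proof
    assume "?s u = ?s v"
    moreover have "v \<in> ?s v" using that(2) by (simp add: s)
    ultimately have "v \<in> ?s u" by simp
    then show "(u, v) \<in> (hadj G ?D)\<^sup>*" by (simp add: s)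
  next
    assume uv: "(u, v) \<in> (hadj G ?D)\<^sup>*"
    have vu: "(v, u) \<in> (hadj G ?D)\<^sup>*" using uv hadj_rtrancl_sym[OF G D] by metis
    show "?s u = ?s v"
      unfolding s using rtrancl_trans[OF uv] rtrancl_trans[OF vu] by blast
  qed
  have "2 * int (contract_weight G w S y) - 2 =
        (\<Sum>u | u \<in> verts G \<and> ?s u = y. 2 * int (w u) - 2) + int (card {h \<in> ?D. ?s (endpt G h) = y})"
    if y: "y \<in> ?s ` verts G" for y
  proof -
    obtain v where v: "v \<in> verts G" "y = ?s v" using y by blast
    let ?H = "{h \<in> ?D. ?s (endpt G h) = y}" and ?X = "{u \<in> verts G. ?s u = y}"
    have X: "?X = {u \<in> verts G. (v, u) \<in> (hadj G ?D)\<^sup>*}"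
      using v s_eq by (metis (lifting))
    have H: "?H = {h \<in> ?D. endpt G h \<in> ?X}" using p(5) by (auto simp: hset_def)
    have le: "2 * card ?X \<le> card ?H + 2"
      unfolding H by (rule component_card_le[OF G D v(1) X])
    \<comment> \<open>Both ends of a contracted edge lie in one fibre, so the half-edges
      \<open>?H\<close> form whole edges.\<close>
    have "?s (endpt G (opp G h)) = ?s (endpt G h)" if "h \<in> ?D" for h
      using that p(3,5)
      by (subst s_eq) (auto simp: hset_def hadj_def insert_commute p(4)
          intro!: r_into_rtrancl exI[of _ "opp G h"])
    then have "card ?H = 2 * card {{h, opp G h} | h. h \<in> ?H}"
      using p D finite_subset[of ?H "hedges G"]
      by (intro involution_orbits_card) (auto simp: edge_closed_def hset_def)
    moreover have "{{h, opp G h} | h. h \<in> ?H} = edges (contr_fiber G S y)"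
      using D by (auto simp: edges_def contr_fiber_def hset_def edge_closed_def)
    ultimately have "int (betti1 (contr_fiber G S y)) = int (card (edges (contr_fiber G S y))) + 1 - int (card ?X)"
      and "card ?H = 2 * card (edges (contr_fiber G S y))"
      using le by (auto simp: betti1_def contr_fiber_def)
    then show ?thesis
      by (simp add: contract_weight_def sum_subtractf sum_distrib_left)
  qed
  moreover have "hedges G - ?D = hedges (contract G S)" by (auto simp: contract_def hset_def)
  ultimately show ?thesis
    using G D s_eq unfolding contraction_def by (auto simp: contract_def bij_betw_def)
qed

text \<open>When nothing is contracted the fibres are single vertices, and the weight clause reduces
  to equality of weights.\<close>

lemma contraction_empty_iff:
  assumes "pregraph G"
  shows "contraction f a {} G w G' w' \<longleftrightarrow> lgraph_iso_by f a G G' \<and> (\<forall>v \<in> verts G. w' (f v) = w v)"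
proof -
  have e: "edge_closed G {}" by (simp add: edge_closed_def)
  have h: "(u, v) \<in> (hadj G {})\<^sup>* \<longleftrightarrow> u = v" for u v by (simp add: hadj_def)
  have w: "(2 * int (w' y) - 2 = (\<Sum>u | u \<in> verts G \<and> f u = y. 2 * int (w u) - 2)) \<longleftrightarrow> w' (f v) = w v"
    if "inj_on f (verts G)" "v \<in> verts G" "y = f v" for v y
  proof -
    have "{u. u \<in> verts G \<and> f u = y} = {v}" using that by (auto dest: inj_onD)
    then show ?thesis using that(3) by auto
  qed
  show ?thesis
  proof
    assume c: "contraction f a {} G w G' w'"
    have inj: "inj_on f (verts G)" using contractionD(4)[OF c] by (auto simp: h intro: inj_onI)
    show "lgraph_iso_by f a G G' \<and> (\<forall>v \<in> verts G. w' (f v) = w v)"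
      using contractionD[OF c] inj w[OF inj]
      by (auto simp: lgraph_iso_by_def bij_betw_def)
  next
    assume i: "lgraph_iso_by f a G G' \<and> (\<forall>v \<in> verts G. w' (f v) = w v)"
    then have inj: "inj_on f (verts G)" and im: "f ` verts G = verts G'"
      by (auto simp: lgraph_iso_by_def bij_betw_def)
    have "\<forall>y\<in>verts G'. 2 * int (w' y) - 2 = (\<Sum>u | u \<in> verts G \<and> f u = y. 2 * int (w u) - 2)"
      unfolding im[symmetric] using w[OF inj] i by blast
    then show "contraction f a {} G w G' w'"
      using i assms e inj im unfolding contraction_def lgraph_iso_by_def h
      by (auto dest: inj_onD)
  qed
qed

section \<open>Isomorphism of tropical curves through contractions\<close>

lemma tcurve_iso_iff:
  assumes "pregraph G"
  shows "tcurve_iso (G, w, l) (G', w', l') \<longleftrightarrow>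
    (\<exists>f a. contraction f a {} G w G' w' \<and> (\<forall>e\<in>edges G. l' (a ` e) = l e))"
  unfolding tcurve_iso_def contraction_empty_iff[OF assms] by simp

lemma contraction_refl: "pregraph G \<Longrightarrow> contraction (\<lambda>v. v) (\<lambda>h. h) {} G w G w"
  by (simp add: contraction_empty_iff lgraph_iso_by_def bij_betw_def)

lemma contraction_edges:
  assumes "contraction f a D G w G' w'"
  shows "edges G' = {a ` {h, opp G h} | h. h \<in> hedges G - D \<and> opp G h \<noteq> h}"
proof -
  note c = contractionD[OF assms]
  have inj: "inj_on a (hedges G - D)" and H: "hedges G' = a ` (hedges G - D)"
    using c(5) by (auto simp: bij_betw_def)
  have "opp G' (a h) = a h \<longleftrightarrow> opp G h = h" if "h \<in> hedges G - D" for h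
    using c(6)[OF that] edge_closed_opp_notin[OF c(1,2) that] inj that by (auto dest: inj_onD)
  then show ?thesis unfolding edges_def H using c(6) by (auto; metis DiffI imageI)
qed

lemma tcurve_iso_refl:
  assumes "pregraph G"
  shows "tcurve_iso (G, w, l) (G, w, l)"
  unfolding tcurve_iso_iff[OF assms]
  by (rule exI[of _ "\<lambda>v. v"], rule exI[of _ "\<lambda>h. h"]) (simp add: contraction_refl[OF assms])

text \<open>The inverse arises by factoring the identity of \<open>G\<close> through the given
  isomorphism.\<close>

lemma tcurve_iso_sym:
  assumes G: "pregraph G" and iso: "tcurve_iso (G, w, l) (G', w', l')"
  shows "tcurve_iso (G', w', l') (G, w, l)"
proof -
  obtain f a where fa: "contraction f a {} G w G' w'" "\<forall>e\<in>edges G. l' (a ` e) = l e"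
    using iso by (auto simp: tcurve_iso_iff[OF G])
  obtain f' a' where fa': "contraction f' a' (a ` ({} - {})) G' w' G w"
    "\<And>h. h \<in> hedges G - {} \<Longrightarrow> a' (a h) = h"
    by (rule contraction_factor[OF fa(1) contraction_refl[OF G, of w]]) auto
  have "l (a' ` e) = l' e" if e: "e \<in> edges G'" for e
  proof -
    obtain h where h: "e = a ` {h, opp G h}" "h \<in> hedges G" "opp G h \<noteq> h"
      using e unfolding contraction_edges[OF fa(1)] by blast
    then have "a' ` e = {h, opp G h}" using fa'(2) pregraphD(3)[OF G] by auto
    moreover have "{h, opp G h} \<in> edges G" using h by (simp add: pair_in_edges_iff)
    ultimately show ?thesis using fa(2) h(1) by metis
  qed
  then show ?thesis using fa'(1) contraction_pregraph[OF fa(1)] by (auto simp: tcurve_iso_iff)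
qed

lemma tcurve_iso_trans:
  assumes G: "pregraph G" and iso: "tcurve_iso (G, w, l) (G1, w1, l1)" "tcurve_iso (G1, w1, l1) (G2, w2, l2)"
  shows "tcurve_iso (G, w, l) (G2, w2, l2)"
proof -
  obtain f a where fa: "contraction f a {} G w G1 w1" "\<forall>e\<in>edges G. l1 (a ` e) = l e"
    using iso by (auto simp: tcurve_iso_iff[OF G])
  obtain f' a' where fa': "contraction f' a' {} G1 w1 G2 w2" "\<forall>e\<in>edges G1. l2 (a' ` e) = l1 e"
    using iso by (auto simp: tcurve_iso_iff[OF contraction_pregraph[OF fa(1)]])
  have "contraction (f' \<circ> f) (a' \<circ> a) {} G w G2 w2"
    using contraction_comp[OF fa(1) fa'(1)] by simp
  moreover have "l2 ((a' \<circ> a) ` e) = l e" if "e \<in> edges G" for e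
  proof -
    have "a ` e \<in> edges G1" using that unfolding contraction_edges[OF fa(1)] edges_def[of G] by blast
    then show ?thesis using fa(2) fa'(2) that by (metis image_comp)
  qed
  ultimately show ?thesis unfolding tcurve_iso_iff[OF G] by blast
qed

section \<open>The curve at a point of a closed cell\<close>

text \<open>For a leg the set \<open>{h, opp G h}\<close> is a singleton and not an edge, so
  \<open>t\<close> carries no information there; legs are therefore excluded.\<close>

definition zero_hedges :: "('v, 'h) lgraph \<Rightarrow> ('h set \<Rightarrow> real) \<Rightarrow> 'h set" where
  "zero_hedges G t = {h \<in> hedges G. opp G h \<noteq> h \<and> t {h, opp G h} = 0}"

lemma hset_zero: "hset G {e \<in> edges G. t e = 0} = zero_hedges G t"
  using pair_in_edges_iff[of _ G] unfolding hset_def zero_hedges_def by blast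

lemma curve_at_eq:
  "curve_at (G, t) = (contract G {e \<in> edges G. t e = 0}, contract_weight G (\<lambda>_. 0) {e \<in> edges G. t e = 0}, t)"
  by (simp add: curve_at_def curve_of_def Let_def)

lemma curve_at_contraction:
  assumes "pregraph G" "curve_at (G, t) = (K, w, l)"
  obtains f where "contraction f (\<lambda>h. h) (zero_hedges G t) G (\<lambda>_. 0) K w" "l = t"
proof -
  have "contraction (contr_map G {e \<in> edges G. t e = 0}) (\<lambda>h. h) (zero_hedges G t) G (\<lambda>_. 0) K w" "l = t"
    using assms contract_contraction[OF assms(1), of "{e \<in> edges G. t e = 0}" "\<lambda>_. 0"]
    by (auto simp: curve_at_eq hset_zero)
  then show ?thesis by (rule that)
qed

text \<open>The contraction of \<open>G\<close> onto the curve at \<open>(G, t)\<close> is composed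
  with an isomorphism in one direction; in the other, a contraction with the same zero set is
  factored through it.\<close>

lemma curve_at_iso_iff:
  assumes G: "pregraph G"
  shows "tcurve_iso (curve_at (G, t)) (G', w', l') \<longleftrightarrow>
    (\<exists>f a. contraction f a (zero_hedges G t) G (\<lambda>_. 0) G' w' \<and>
      (\<forall>h \<in> hedges G - zero_hedges G t. opp G h \<noteq> h \<longrightarrow> l' (a ` {h, opp G h}) = t {h, opp G h}))"
    (is "_ \<longleftrightarrow> (\<exists>f a. ?P f a)")
proof -
  obtain K w l where K: "curve_at (G, t) = (K, w, l)" using prod_cases3 by blast
  obtain s where s: "contraction s (\<lambda>h. h) (zero_hedges G t) G (\<lambda>_. 0) K w" "l = t"
    using curve_at_contraction[OF G K] .
  have KG: "pregraph K" using contraction_pregraph[OF s(1)] .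
  have E: "edges K = {{h, opp G h} | h. h \<in> hedges G - zero_hedges G t \<and> opp G h \<noteq> h}"
    using contraction_edges[OF s(1)] by simp
  show ?thesis
  proof
    assume "tcurve_iso (curve_at (G, t)) (G', w', l')"
    then obtain f a where fa: "contraction f a {} K w G' w'" "\<forall>e\<in>edges K. l' (a ` e) = t e"
      unfolding K by (auto simp: tcurve_iso_iff[OF KG] s(2))
    have "contraction (f \<circ> s) a (zero_hedges G t) G (\<lambda>_. 0) G' w'"
      using contraction_comp[OF s(1) fa(1)] by (simp add: comp_def)
    then show "\<exists>f a. ?P f a" using fa(2) unfolding E by blast
  next
    assume "\<exists>f a. ?P f a"
    then obtain f a where fa: "?P f a" by blast
    obtain f' a' where fa': "contraction f' a' ((\<lambda>h. h) ` (zero_hedges G t - zero_hedges G t)) K w G' w'"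
      "\<And>h. h \<in> hedges G - zero_hedges G t \<Longrightarrow> a' h = a h"
      by (rule contraction_factor[OF s(1) conjunct1[OF fa] order_refl]) blast
    have "l' (a' ` e) = t e" if e: "e \<in> edges K" for e
    proof -
      obtain h where h: "e = {h, opp G h}" "h \<in> hedges G - zero_hedges G t" "opp G h \<noteq> h"
        using e E by blast
      moreover have "opp G h \<in> hedges G - zero_hedges G t"
        using edge_closed_opp_notin[OF contractionD(1,2)[OF s(1)] h(2)] .
      ultimately have "a' ` e = a ` {h, opp G h}" using fa'(2) by simp
      then show ?thesis using fa h by simp
    qed
    then show "tcurve_iso (curve_at (G, t)) (G', w', l')"
      using fa'(1) unfolding K by (auto simp: tcurve_iso_iff[OF KG] s(2))
  qed
qed

lemma cubic_graphsD:
  assumes "G \<in> cubic_graphs g n"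
  shows "is_lgraph G" "pregraph G" "card (legs G) = n" "stable G (\<lambda>_. 0)" "genus G (\<lambda>_. 0) = g"
  using assms by (auto simp: cubic_graphs_def is_lgraph_iff stable_iff three_regular_def genus_def)

lemma topspace_Rbar: "topspace (Rbar G) = edges G \<rightarrow>\<^sub>E {0..}"
  by (simp add: Rbar_def)

text \<open>Everything but positivity passes along the contraction. An edge of the curve lies
  outside the zero set, and a nonzero length in the orthant is positive.\<close>

lemma curve_at_tcurves:
  assumes G: "G \<in> cubic_graphs g n" and t: "t \<in> topspace (Rbar G)"
  shows "curve_at (G, t) \<in> tcurves g n"
proof -
  note g = cubic_graphsD[OF G]
  obtain K w l where K: "curve_at (G, t) = (K, w, l)" using prod_cases3 by blast
  obtain s where s: "contraction s (\<lambda>h. h) (zero_hedges G t) G (\<lambda>_. 0) K w" "l = t"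
    using curve_at_contraction[OF g(2) K] .
  have "0 < t e" if e: "e \<in> edges K" for e
  proof -
    obtain h where h: "e = {h, opp G h}" "h \<in> hedges G" "t e \<noteq> 0" "opp G h \<noteq> h"
      using e unfolding contraction_edges[OF s(1)] zero_hedges_def by auto
    then have "0 \<le> t e" using t pair_in_edges_iff[of h G] by (auto simp: topspace_Rbar PiE_iff)
    then show ?thesis using h(3) by simp
  qed
  then show ?thesis
    using contraction_is_lgraph_iff[OF s(1)] contraction_legs(2)[OF s(1)] contraction_stable[OF s(1)]
      contraction_genus[OF s(1)] g
    by (simp add: K s(2) tcurves_def)
qed

lemma tcurve_iso_tcurves:
  assumes "(G, w, l) \<in> tcurves g n" "contraction f a {} G w G' w'" "\<And>e. e \<in> edges G' \<Longrightarrow> 0 < l' e"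
  shows "(G', w', l') \<in> tcurves g n"
  using assms contraction_is_lgraph_iff[OF assms(2)] contraction_legs(2)[OF assms(2)]
    contraction_stable[OF assms(2)] contraction_genus[OF assms(2)]
  by (simp add: tcurves_def)

lemma tcurves_pregraph: "(G, w, l) \<in> tcurves g n \<Longrightarrow> pregraph G"
  by (simp add: tcurves_def is_lgraph_iff)

text \<open>The vertices of the curve at a point are sets of vertices; renaming them brings the
  curve to the type on which isomorphism classes are formed.\<close>

lemma tcurve_nat_copy:
  fixes C :: "('v, 'h) tcurve"
  assumes "C \<in> tcurves g n"
  obtains C' :: "(nat, 'h) tcurve" where "C' \<in> tcurves g n" "tcurve_iso C C'"
proof -
  obtain G w l where C: "C = (G, w, l)" using prod_cases3 by blast
  have G: "pregraph G" using assms tcurves_pregraph C by blast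
  obtain f :: "'v \<Rightarrow> nat" where f: "inj_on f (verts G)"
    using pregraphD(1)[OF G] finite_imp_inj_to_nat_seg by blast
  define G' where "G' = \<lparr>verts = f ` verts G, hedges = hedges G, opp = opp G, endpt = f \<circ> endpt G, leg = leg G\<rparr>"
  define w' where "w' = w \<circ> inv_into (verts G) f"
  have c: "contraction f (\<lambda>h. h) {} G w G' w'"
    unfolding contraction_empty_iff[OF G] lgraph_iso_by_def
    using f by (simp add: G'_def w'_def bij_betw_def)
  have E: "edges G' = edges G" by (simp add: edges_def G'_def)
  have "(G', w', l) \<in> tcurves g n"
    using assms unfolding C by (intro tcurve_iso_tcurves[OF _ c]) (auto simp: E tcurves_def)
  moreover have "tcurve_iso C (G', w', l)"
    using c unfolding C tcurve_iso_iff[OF G] by (intro exI[of _ f] exI[of _ "\<lambda>h. h"]) simp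
  ultimately show ?thesis by (rule that)
qed

section \<open>Expansion to cubic graphs\<close>

text \<open>Lowering the weight at \<open>v\<close> by one changes \<open>2 w - 2\<close> by two,
  which the two half-edges of the new loop make up for.\<close>

lemma contraction_loop:
  assumes G: "pregraph G" and v: "v \<in> verts G" "0 < w v"
    and h: "h1 \<noteq> h2" "h1 \<notin> hedges G" "h2 \<notin> hedges G"
    and G': "G' = \<lparr>verts = verts G, hedges = {h1, h2} \<union> hedges G, opp = (opp G)(h1 := h2, h2 := h1),
      endpt = (endpt G)(h1 := v, h2 := v), leg = leg G\<rparr>"
  shows "contraction (\<lambda>u. u) (\<lambda>h. h) {h1, h2} G' (w(v := w v - 1)) G w"
proof -
  note p = pregraphD[OF G]
  have neq: "k \<noteq> h1" "k \<noteq> h2" "opp G k \<noteq> h1" "opp G k \<noteq> h2" if "k \<in> hedges G" for k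
    using that h p(3)[OF that] by auto
  have legs: "legs G' = legs G" using h neq by (auto simp: legs_def G')
  have "hadj G' {h1, h2} = {(v, v)}" using h by (auto simp: hadj_def G')
  moreover have "(x, y) \<in> {(v, v)}\<^sup>* \<Longrightarrow> x = y" for x y
    by (induction rule: rtrancl_induct) auto
  ultimately have adj: "(hadj G' {h1, h2})\<^sup>* = Id" by auto
  have "pregraph G'"
    using p h neq v unfolding pregraph_def legs by (auto simp: G')
  moreover have "edge_closed G' {h1, h2}" using h by (auto simp: edge_closed_def G')
  moreover have "{u. u \<in> verts G' \<and> u = y} = {y}" if "y \<in> verts G" for y using that by (auto simp: G')
  moreover have "{h \<in> {h1, h2}. endpt G' h = y} = (if y = v then {h1, h2} else {})" for y
    using h by (auto simp: G')
  moreover have "hedges G' - {h1, h2} = hedges G" using h by (auto simp: G')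
  ultimately show ?thesis
    unfolding contraction_def using v h neq adj by (auto simp: legs G' bij_betw_def)
qed

text \<open>The half-edges in \<open>B\<close> move to the new vertex \<open>z\<close>, joined to
  \<open>v\<close> by the edge of \<open>h1\<close> and \<open>h2\<close>. The term
  \<open>-2\<close> of \<open>z\<close> cancels against these two half-edges.\<close>

lemma contraction_split:
  assumes G: "pregraph G" and v: "v \<in> verts G" "z \<notin> verts G" and B: "B \<subseteq> {h \<in> hedges G. endpt G h = v}"
    and h: "h1 \<noteq> h2" "h1 \<notin> hedges G" "h2 \<notin> hedges G"
    and G': "G' = \<lparr>verts = insert z (verts G), hedges = {h1, h2} \<union> hedges G, opp = (opp G)(h1 := h2, h2 := h1),
      endpt = (\<lambda>h. if h = h1 then v else if h = h2 \<or> h \<in> B then z else endpt G h), leg = leg G\<rparr>"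
  shows "contraction ((\<lambda>u. u)(z := v)) (\<lambda>h. h) {h1, h2} G' (w(z := 0)) G w"
proof -
  note p = pregraphD[OF G]
  let ?f = "(\<lambda>u. u)(z := v)"
  have vz: "v \<noteq> z" using v by auto
  have neq: "k \<noteq> h1" "k \<noteq> h2" "opp G k \<noteq> h1" "opp G k \<noteq> h2" if "k \<in> hedges G" for k
    using that h p(3)[OF that] by auto
  have legs: "legs G' = legs G" using h neq by (auto simp: legs_def G')
  have hadj: "hadj G' {h1, h2} = {(v, z), (z, v)}" using h by (auto simp: hadj_def G')
  have adj: "?f x = ?f y \<longleftrightarrow> (x, y) \<in> (hadj G' {h1, h2})\<^sup>*" for x y
  proof
    assume "?f x = ?f y"
    then have "x = y \<or> (x, y) \<in> {(v, z), (z, v)}" by (auto split: if_splits)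
    then show "(x, y) \<in> (hadj G' {h1, h2})\<^sup>*" unfolding hadj by auto
  next
    assume "(x, y) \<in> (hadj G' {h1, h2})\<^sup>*"
    then show "?f x = ?f y" unfolding hadj by (induction rule: rtrancl_induct) auto
  qed
  have endpt: "endpt G h = v" if "h \<in> B" for h using B that by auto
  have "pregraph G'"
    using p h neq v unfolding pregraph_def legs by (auto simp: G')
  moreover have "edge_closed G' {h1, h2}" using h by (auto simp: edge_closed_def G')
  moreover have "(\<Sum>u | u \<in> verts G' \<and> ?f u = y. 2 * int ((w(z := 0)) u) - 2) +
      int (card {h \<in> {h1, h2}. ?f (endpt G' h) = y}) = 2 * int (w y) - 2" if y: "y \<in> verts G" for y
  proof (cases "y = v")
    case True
    have "{u. u \<in> verts G' \<and> ?f u = y} = {v, z}" using True v by (auto simp: G')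
    moreover have "{h \<in> {h1, h2}. ?f (endpt G' h) = y} = {h1, h2}" using True v h by (auto simp: G')
    ultimately show ?thesis using vz h True by simp
  next
    case False
    have "{u. u \<in> verts G' \<and> ?f u = y} = {y}" using False v y by (auto simp: G')
    moreover have "{h \<in> {h1, h2}. ?f (endpt G' h) = y} = {}" using False v h by (auto simp: G')
    ultimately show ?thesis using y v by auto
  qed
  moreover have "hedges G' - {h1, h2} = hedges G" using h by (auto simp: G')
  moreover have "?f ` verts G' = verts G" using v by (auto simp: G')
  moreover have "opp G (h) = opp G' h \<and> endpt G h = ?f (endpt G' h)" if "h \<in> hedges G" for h
    using that neq endpt p(5) v by (auto simp: G')
  moreover have "leg G' = leg G" by (simp add: G')
  ultimately show ?thesis
    unfolding contraction_def using adj by (auto simp: legs bij_betw_def simp del: fun_upd_apply)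
qed

lemma sum_valence:
  assumes "pregraph G"
  shows "(\<Sum>v\<in>verts G. valence G v) = card (hedges G)"
proof -
  note p = pregraphD[OF assms]
  have "(\<Sum>v\<in>verts G. valence G v) = (\<Sum>v\<in>verts G. \<Sum>h | h \<in> hedges G \<and> endpt G h = v. 1)"
    by (simp add: valence_def)
  also have "\<dots> = (\<Sum>h\<in>hedges G. 1)" using p by (intro sum.group) auto
  finally show ?thesis by simp
qed

text \<open>For a stable graph, the codimension of its cell in the moduli space.\<close>

definition codim :: "('v, 'h) lgraph \<Rightarrow> ('v \<Rightarrow> nat) \<Rightarrow> int" where
  "codim G w = 3 * (\<Sum>v\<in>verts G. int (w v)) + int (card (hedges G)) - 3 * int (card (verts G))"

text \<open>By \<open>sum_valence\<close>, \<open>codim\<close> is the sum over the vertices of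
  three times the weight plus the valence minus three, and stability makes each term
  nonnegative.\<close>

lemma codim_nonneg:
  assumes "pregraph G" "stable G w"
  shows "0 \<le> codim G w"
proof -
  have "0 \<le> (\<Sum>v\<in>verts G. 3 * int (w v) + int (valence G v) - 3)"
    using assms(2) unfolding stable_iff by (intro sum_nonneg) force
  also have "\<dots> = codim G w"
    by (simp add: codim_def sum.distrib sum_subtractf sum_distrib_left flip: sum_valence[OF assms(1)])
  finally show ?thesis .
qed

text \<open>A positive weight is traded for a loop, which changes \<open>codim\<close> by
  \<open>-3 + 2\<close>. At weight zero stability forces valence above three, and splitting the
  vertex changes \<open>codim\<close> by \<open>2 - 3\<close>.\<close>

lemma expansion_step:
  fixes G :: "(nat, nat) lgraph"
  assumes G: "pregraph G" and st: "stable G w" and v: "v \<in> verts G" "w v \<noteq> 0 \<or> valence G v \<noteq> 3"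
  obtains f a D and G' :: "(nat, nat) lgraph" and w'
    where "contraction f a D G' w' G w" "stable G' w'" "codim G' w' < codim G w"
proof -
  note p = pregraphD[OF G]
  obtain h1 where h1: "h1 \<notin> hedges G" using ex_new_if_finite[OF infinite_UNIV_nat p(2)] by blast
  obtain h2 where h2: "h2 \<notin> insert h1 (hedges G)"
    using ex_new_if_finite[OF infinite_UNIV_nat finite.insertI[OF p(2)]] by blast
  obtain z where z: "z \<notin> verts G" using ex_new_if_finite[OF infinite_UNIV_nat p(1)] by blast
  have h: "h1 \<noteq> h2" "h1 \<notin> hedges G" "h2 \<notin> hedges G" using h1 h2 by auto
  show ?thesis
  proof (cases "w v = 0")
    case False
    define G' where "G' = \<lparr>verts = verts G, hedges = {h1, h2} \<union> hedges G, opp = (opp G)(h1 := h2, h2 := h1),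
      endpt = (endpt G)(h1 := v, h2 := v), leg = leg G\<rparr>"
    let ?w = "w(v := w v - 1)"
    have c: "contraction (\<lambda>u. u) (\<lambda>h. h) {h1, h2} G' ?w G w"
      using False by (intro contraction_loop[OF G v(1) _ h G'_def]) simp
    have "3 \<le> valence G' u + 2 * ?w u" if u: "u \<in> verts G'" for u
    proof -
      have "{h \<in> hedges G'. endpt G' h = u} = {h \<in> hedges G. endpt G h = u} \<union> (if u = v then {h1, h2} else {})"
        using h by (auto simp: G'_def)
      then have "valence G' u = card ({h \<in> hedges G. endpt G h = u} \<union> (if u = v then {h1, h2} else {}))"
        by (simp add: valence_def)
      also have "\<dots> = valence G u + (if u = v then 2 else 0)"
        using h p(2) by (subst card_Un_disjoint) (auto simp: valence_def)
      finally have "valence G' u = valence G u + (if u = v then 2 else 0)" .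
      moreover have "3 \<le> valence G u + 2 * w u" using st u by (simp add: stable_iff G'_def)
      ultimately show ?thesis using False by auto
    qed
    then have st': "stable G' ?w" by (simp add: stable_iff)
    have "(\<Sum>u\<in>verts G. int (?w u)) = (\<Sum>u\<in>verts G. int (w u) - (if u = v then 1 else 0))"
      using False by (intro sum.cong) auto
    also have "\<dots> = (\<Sum>u\<in>verts G. int (w u)) - 1"
      using v p(1) by (simp add: sum_subtractf sum.delta)
    finally have s: "(\<Sum>u\<in>verts G. int (?w u)) = (\<Sum>u\<in>verts G. int (w u)) - 1" .
    have "codim G' ?w < codim G w"
    proof -
      have "verts G' = verts G" "hedges G' = {h1, h2} \<union> hedges G" by (simp_all add: G'_def)
      then show ?thesis unfolding codim_def by (simp only: s) (use h p(2) in simp)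
    qed
    then show ?thesis by (rule that[OF c st'])
  next
    case True
    have val: "3 < valence G v" using st v True by (auto simp: stable_iff)
    \<comment> \<open>Two half-edges move: \<open>z\<close> gets valence three with
      \<open>h2\<close>, and \<open>v\<close> loses two and gains \<open>h1\<close>, so at least
      three remain.\<close>
    then obtain B where B: "B \<subseteq> {h \<in> hedges G. endpt G h = v}" "card B = 2"
      using obtain_subset_with_card_n[of 2 "{h \<in> hedges G. endpt G h = v}"] by (auto simp: valence_def)
    define G' where "G' = \<lparr>verts = insert z (verts G), hedges = {h1, h2} \<union> hedges G, opp = (opp G)(h1 := h2, h2 := h1),
      endpt = (\<lambda>h. if h = h1 then v else if h = h2 \<or> h \<in> B then z else endpt G h), leg = leg G\<rparr>"
    let ?w = "w(z := 0)"
    have c: "contraction ((\<lambda>u. u)(z := v)) (\<lambda>h. h) {h1, h2} G' ?w G w"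
      by (rule contraction_split[OF G v(1) z B(1) h G'_def])
    have vz: "v \<noteq> z" using v z by auto
    have finB: "finite B" using B(2) card.infinite by fastforce
    have hB: "h1 \<notin> B" "h2 \<notin> B" using B(1) h by auto
    have "3 \<le> valence G' u + 2 * ?w u" if u: "u \<in> verts G'" for u
    proof -
      consider "u = z" | "u = v" | "u \<in> verts G" "u \<noteq> v" "u \<noteq> z" using u by (auto simp: G'_def)
      then show ?thesis
      proof cases
        case 1
        have "{h \<in> hedges G'. endpt G' h = u} = insert h2 B"
          using 1 B(1) h hB vz z p(5) by (auto simp: G'_def)
        then show ?thesis using B(2) finB hB by (simp add: valence_def)
      next
        case 2
        have "{h \<in> hedges G'. endpt G' h = u} = insert h1 ({h \<in> hedges G. endpt G h = v} - B)"
          using 2 B(1) h hB vz by (auto simp: G'_def)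
        then have "valence G' u = Suc (card ({h \<in> hedges G. endpt G h = v} - B))"
          using h p(2) by (simp add: valence_def)
        then show ?thesis using val B finB by (simp add: card_Diff_subset valence_def)
      next
        case 3
        have "{h \<in> hedges G'. endpt G' h = u} = {h \<in> hedges G. endpt G h = u}"
          using 3 B(1) h by (auto simp: G'_def)
        then show ?thesis using st 3 by (simp add: valence_def stable_iff)
      qed
    qed
    then have st': "stable G' ?w" by (simp add: stable_iff)
    have "(\<Sum>u\<in>verts G. int (?w u)) = (\<Sum>u\<in>verts G. int (w u))"
      using z by (intro sum.cong) auto
    then have "codim G' ?w < codim G w"
      using h p(1,2) z by (simp only: codim_def) (simp add: G'_def)
    then show ?thesis by (rule that[OF c st'])
  qed
qed

text \<open>Steps are iterated by induction on \<open>codim\<close>. Nonnegativity for the expanded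
  graph keeps the decrease strict under \<open>nat\<close>.\<close>

lemma exists_cubic_expansion:
  fixes G :: "(nat, nat) lgraph"
  assumes "pregraph G" "stable G w"
  shows "\<exists>(G' :: (nat, nat) lgraph) f a D. contraction f a D G' (\<lambda>_. 0) G w \<and> three_regular G'"
  using assms
proof (induction "nat (codim G w)" arbitrary: G w rule: less_induct)
  case less
  show ?case
  proof (cases "\<forall>v\<in>verts G. w v = 0 \<and> valence G v = 3")
    case True
    have "contraction (\<lambda>v. v) (\<lambda>h. h) {} G (\<lambda>_. 0) G w"
      using contraction_cong[OF contraction_refl[OF less.prems(1), of w]] True by simp
    then show ?thesis using True unfolding three_regular_def by blast
  next
    case False
    then obtain v where v: "v \<in> verts G" "w v \<noteq> 0 \<or> valence G v \<noteq> 3" by blast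
    obtain f a D and G1 :: "(nat, nat) lgraph" and w1 where
      1: "contraction f a D G1 w1 G w" "stable G1 w1" "codim G1 w1 < codim G w"
      using expansion_step[OF less.prems v] .
    have G1: "pregraph G1" using contractionD(1)[OF 1(1)] .
    have "nat (codim G1 w1) < nat (codim G w)"
      using 1(3) codim_nonneg[OF G1 1(2)] by simp
    then obtain G' :: "(nat, nat) lgraph" and f' a' D' where
      "contraction f' a' D' G' (\<lambda>_. 0) G1 w1" "three_regular G'"
      using less.hyps[OF _ G1 1(2)] by blast
    then show ?thesis using contraction_comp[OF _ 1(1)] by blast
  qed
qed

section \<open>Lengths pulled back along a contraction\<close>

text \<open>Contracted edges receive length zero. Testing \<open>e \<subseteq> D\<close> suffices
  because an edge-closed set contains both half-edges of an edge or neither.\<close>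

definition pulled_length :: "'h set \<Rightarrow> ('h \<Rightarrow> 'k) \<Rightarrow> ('k set \<Rightarrow> real) \<Rightarrow> 'h set \<Rightarrow> real" where
  "pulled_length D a l e = (if e \<subseteq> D then 0 else l (a ` e))"

lemma pulled_length_pair:
  assumes "edge_closed G D" "pregraph G" "h \<in> hedges G"
  shows "pulled_length D a l {h, opp G h} = (if h \<in> D then 0 else l (a ` {h, opp G h}))"
  using assms edge_closed_opp_notin[OF assms(2,1), of h] by (auto simp: pulled_length_def edge_closed_def)

text \<open>Positivity of \<open>l\<close> makes the zero set of \<open>t\<close> exactly
  \<open>D\<close>, so that \<open>curve_at_iso_iff\<close> applies with the given
  contraction.\<close>

lemma curve_at_pulled_length:
  assumes c: "contraction f a D G (\<lambda>_. 0) G' w'" and l: "\<And>e. e \<in> edges G' \<Longrightarrow> 0 < l e"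
    and t: "\<And>e. e \<in> edges G \<Longrightarrow> t e = pulled_length D a l e"
  shows "tcurve_iso (curve_at (G, t)) (G', w', l)"
proof -
  note cD = contractionD[OF c]
  have D: "D \<subseteq> {h \<in> hedges G. opp G h \<noteq> h}" using cD(2) by (auto simp: edge_closed_def)
  have t': "t {h, opp G h} = (if h \<in> D then 0 else l (a ` {h, opp G h}))"
    if "h \<in> hedges G" "opp G h \<noteq> h" for h
    using that t[of "{h, opp G h}"] pulled_length_pair[OF cD(2,1) that(1), of a l]
      pair_in_edges_iff[of h G] by simp
  have pos: "0 < l (a ` {h, opp G h})" if "h \<in> hedges G" "opp G h \<noteq> h" "h \<notin> D" for h
    using that by (intro l) (auto simp only: contraction_edges[OF c] Diff_iff mem_Collect_eq)
  have "zero_hedges G t = D"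
  proof -
    have "t {h, opp G h} = 0 \<longleftrightarrow> h \<in> D" if h: "h \<in> hedges G" "opp G h \<noteq> h" for h
      using t'[OF h] pos[OF h] by (cases "h \<in> D") auto
    then show ?thesis unfolding zero_hedges_def using D by blast
  qed
  then show ?thesis
    unfolding curve_at_iso_iff[OF cD(1)] using c t' by (intro exI[of _ f] exI[of _ a]) auto
qed

section \<open>Topology of the moduli space\<close>

text \<open>A saturated set is the full preimage of its image.\<close>

lemma openin_quotient_image:
  assumes r: "equiv (topspace X) r" and N: "openin X N" and sat: "\<And>x y. x \<in> N \<Longrightarrow> (x, y) \<in> r \<Longrightarrow> y \<in> N"
  shows "openin (quotient_topology X r) ((\<lambda>x. r `` {x}) ` N)"
proof -
  have sub: "N \<subseteq> topspace X" using N openin_subset by blast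
  have "{x \<in> topspace X. r `` {x} \<in> (\<lambda>x. r `` {x}) ` N} = N"
  proof (intro subset_antisym subsetI)
    fix x assume "x \<in> {x \<in> topspace X. r `` {x} \<in> (\<lambda>x. r `` {x}) ` N}"
    then obtain y where y: "x \<in> topspace X" "y \<in> N" "r `` {x} = r `` {y}" by auto
    then have "(y, x) \<in> r" using eq_equiv_class[OF y(3)[symmetric] r] by blast
    then show "x \<in> N" using sat y(2) by blast
  qed (use sub in auto)
  moreover have "(\<lambda>x. r `` {x}) ` N \<subseteq> topspace X // r" using sub by (auto intro: quotientI)
  ultimately show ?thesis using N by (simp add: openin_quotient_topology)
qed

text \<open>The preimage of a nonempty open set is open and nonempty, hence meets
  \<open>A\<close>.\<close>

lemma closure_of_quotient_image:
  assumes "X closure_of A = topspace X"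
  shows "quotient_topology X r closure_of ((\<lambda>x. r `` {x}) ` A) = topspace (quotient_topology X r)"
  unfolding dense_intersects_open
proof (intro allI impI)
  fix T assume T: "openin (quotient_topology X r) T \<and> T \<noteq> {}"
  let ?P = "{x \<in> topspace X. r `` {x} \<in> T}"
  have P: "openin X ?P" "T \<subseteq> topspace X // r" using T by (auto simp: openin_quotient_topology)
  obtain Y where "Y \<in> T" using T by blast
  moreover obtain x where "x \<in> topspace X" "Y = r `` {x}"
    using P(2) \<open>Y \<in> T\<close> by (meson quotientE subsetD)
  ultimately have "x \<in> ?P" by simp
  with P have "A \<inter> ?P \<noteq> {}" using assms unfolding dense_intersects_open by blast
  then show "(\<lambda>x. r `` {x}) ` A \<inter> T \<noteq> {}" by blast
qed

lemma openin_Rbar_box: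
  assumes "finite (edges G)" "\<And>e. open (W e)"
  shows "openin (Rbar G) {t \<in> topspace (Rbar G). \<forall>e\<in>edges G. t e \<in> W e}"
proof -
  have "{t \<in> topspace (Rbar G). \<forall>e\<in>edges G. t e \<in> W e} = (\<Pi>\<^sub>E e\<in>edges G. {0..} \<inter> W e)"
    by (auto simp: topspace_Rbar PiE_iff extensional_def)
  moreover have "openin (Rbar G) (\<Pi>\<^sub>E e\<in>edges G. {0..} \<inter> W e)"
    unfolding Rbar_def using assms by (simp add: openin_PiE_gen openin_open_Int)
  ultimately show ?thesis by simp
qed

lemma finite_edges: "pregraph G \<Longrightarrow> finite (edges G)"
proof -
  assume "pregraph G"
  moreover have "edges G \<subseteq> (\<lambda>h. {h, opp G h}) ` hedges G" by (auto simp: edges_def)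
  ultimately show ?thesis using pregraphD(2) finite_surj by blast
qed

lemma Ropen_eq: "Ropen G = {t \<in> topspace (Rbar G). \<forall>e\<in>edges G. t e \<in> {0<..}}"
  by (auto simp: Ropen_def)

text \<open>Closure commutes with products, which reduces the claim to the half-line.\<close>

lemma Ropen_dense: "Rbar G closure_of Ropen G = topspace (Rbar G)"
proof -
  have "closure {0<..} = {0 :: real..}" "{0..} \<inter> {0<..} = {0 :: real<..}" by auto
  then have "top_of_set {0..} closure_of {0<..} = {0 :: real..}"
    by (simp add: closure_of_subtopology)
  moreover have "Ropen G = (\<Pi>\<^sub>E e\<in>edges G. {0<..})"
    by (auto simp: Ropen_eq topspace_Rbar PiE_iff extensional_def less_imp_le)
  ultimately show ?thesis
    by (simp add: Rbar_def closure_of_product_topology)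
qed

lemma topspace_Mspace: "(G, t) \<in> topspace (Mspace Gs) \<longleftrightarrow> G \<in> Gs \<and> t \<in> topspace (Rbar G)"
  by (simp add: Mspace_def)

lemma openin_Mspace:
  assumes "N \<subseteq> topspace (Mspace Gs)"
    and "\<And>G t. (G, t) \<in> N \<Longrightarrow> \<exists>T. openin (Rbar G) T \<and> t \<in> T \<and> (\<forall>t'\<in>T. (G, t') \<in> N)"
  shows "openin (Mspace Gs) N"
  unfolding Mspace_def openin_sum_topology
proof
  show "N \<subseteq> Sigma Gs (topspace \<circ> Rbar)" using assms(1) by (simp add: Mspace_def)
  show "\<forall>G\<in>Gs. openin (Rbar G) {t. (G, t) \<in> N}"
  proof
    fix G
    show "openin (Rbar G) {t. (G, t) \<in> N}"
    proof (subst openin_subopen, intro ballI)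
      fix t assume "t \<in> {t. (G, t) \<in> N}"
      then obtain T where T: "openin (Rbar G) T" "t \<in> T" "\<forall>t'\<in>T. (G, t') \<in> N"
        using assms(2)[of G t] by auto
      then have "T \<subseteq> {t. (G, t) \<in> N}" by auto
      then show "\<exists>T. openin (Rbar G) T \<and> t \<in> T \<and> T \<subseteq> {t. (G, t) \<in> N}" using T by auto
    qed
  qed
qed

lemma dense_open_cells:
  "Mspace Gs closure_of {(G, t). G \<in> Gs \<and> t \<in> Ropen G} = topspace (Mspace Gs)"
  unfolding dense_intersects_open
proof (intro allI impI)
  fix T assume T: "openin (Mspace Gs) T \<and> T \<noteq> {}"
  then obtain G t where Gt: "(G, t) \<in> T" by auto
  have "G \<in> Gs" using T Gt openin_subset[of "Mspace Gs" T] topspace_Mspace by blast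
  moreover then have "openin (Rbar G) {t. (G, t) \<in> T}" using T by (auto simp: Mspace_def openin_sum_topology)
  then have "Ropen G \<inter> {t. (G, t) \<in> T} \<noteq> {}"
    using Ropen_dense[of G] Gt unfolding dense_intersects_open by blast
  ultimately show "{(G, t). G \<in> Gs \<and> t \<in> Ropen G} \<inter> T \<noteq> {}" by blast
qed

lemma tcurves_iso_sym:
  assumes "C \<in> tcurves g n" "tcurve_iso C C'"
  shows "tcurve_iso C' C"
  using assms tcurve_iso_sym tcurves_pregraph by (cases C; cases C') blast

lemma tcurves_iso_trans:
  assumes "C \<in> tcurves g n" "tcurve_iso C C'" "tcurve_iso C' C''"
  shows "tcurve_iso C C''"
  using assms tcurve_iso_trans tcurves_pregraph by (cases C; cases C'; cases C'') blast

lemma tcurves_iso_refl: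
  assumes "C \<in> tcurves g n"
  shows "tcurve_iso C C"
  using assms tcurve_iso_refl tcurves_pregraph by (cases C) blast

lemma equiv_tcurves:
  "equiv (tcurves g n) {(C, D). C \<in> tcurves g n \<and> D \<in> tcurves g n \<and> tcurve_iso C D}"
  by (intro equivI refl_onI symI transI)
     (auto intro: tcurves_iso_refl tcurves_iso_sym tcurves_iso_trans)

lemma curve_at_in_tcurves:
  assumes "Gs \<subseteq> cubic_graphs g n" "x \<in> topspace (Mspace Gs)"
  shows "curve_at x \<in> tcurves g n"
  using assms by (cases x) (auto simp: topspace_Mspace intro: curve_at_tcurves)

lemma equiv_Mrel:
  assumes "Gs \<subseteq> cubic_graphs g n"
  shows "equiv (topspace (Mspace Gs)) (Mrel Gs)"
proof -
  note t = curve_at_in_tcurves[OF assms]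
  show ?thesis
    unfolding Mrel_def
    by (intro equivI refl_onI symI transI)
       (auto intro: tcurves_iso_refl[OF t] tcurves_iso_sym[OF t] tcurves_iso_trans[OF t])
qed

section \<open>Regular and pure points in the closed cells\<close>

lemma tcurve_iso_pure:
  assumes "tcurve_iso C C'" "pure C"
  shows "pure C'"
proof -
  obtain G w l G' w' l' where C: "C = (G, w, l)" "C' = (G', w', l')" by (cases C; cases C') blast
  obtain f a where f: "lgraph_iso_by f a G G'" and w: "\<forall>v\<in>verts G. w' (f v) = w v"
    using assms(1) by (auto simp: tcurve_iso_def C)
  have "verts G' = f ` verts G" using f by (simp add: lgraph_iso_by_def bij_betw_def)
  then show ?thesis using w assms(2) by (simp add: pure_def C)
qed

text \<open>Let \<open>k\<close> vertices and \<open>d\<close> contracted half-edges lie over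
  \<open>y\<close>. The valence of \<open>y\<close> is \<open>3 k - d\<close> and its weight
  satisfies \<open>2 w - 2 = d - 2 k\<close>; valence three and weight zero force
  \<open>k = 1\<close> and \<open>d = 0\<close>.\<close>

lemma regular_curve_at_iff:
  assumes G: "G \<in> cubic_graphs g n" and t: "t \<in> topspace (Rbar G)"
  shows "regular (curve_at (G, t)) \<longleftrightarrow> t \<in> Ropen G"
proof -
  note g = cubic_graphsD[OF G]
  have three: "valence G v = 3" if "v \<in> verts G" for v
    using G that by (simp add: cubic_graphs_def three_regular_def)
  obtain K w l where K: "curve_at (G, t) = (K, w, l)" using prod_cases3 by blast
  obtain s where s: "contraction s (\<lambda>h. h) (zero_hedges G t) G (\<lambda>_. 0) K w" "l = t"
    using curve_at_contraction[OF g(2) K] .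
  note c = contractionD[OF s(1)]
  have val: "valence K y + card {h \<in> zero_hedges G t. s (endpt G h) = y} = 3 * card {u \<in> verts G. s u = y}"
    and wt: "2 * int (w y) - 2 = - 2 * int (card {u \<in> verts G. s u = y}) +
      int (card {h \<in> zero_hedges G t. s (endpt G h) = y})" if "y \<in> verts K" for y
    using contraction_valence[OF s(1) that] c(9)[OF that] three by simp_all
  have fin: "finite (zero_hedges G t)"
    using pregraphD(2)[OF g(2)] by (simp add: zero_hedges_def)
  have zero: "zero_hedges G t = {} \<longleftrightarrow> t \<in> Ropen G"
    using t unfolding Ropen_def ball_edges topspace_Rbar zero_hedges_def
    by (auto simp: PiE_iff pair_in_edges_iff order_less_le Ball_def edges_def)
  show ?thesis
  proof
    assume reg: "regular (curve_at (G, t))"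
    have "h \<notin> zero_hedges G t" for h
    proof
      assume h: "h \<in> zero_hedges G t"
      let ?y = "s (endpt G h)"
      have y: "?y \<in> verts K"
        using h c(11) pregraphD(5)[OF g(2)] by (simp add: zero_hedges_def)
      then have "w ?y = 0" "valence K ?y = 3"
        using reg by (auto simp: K regular_def pure_def three_regular_def)
      then have "card {k \<in> zero_hedges G t. s (endpt G k) = ?y} = 0"
        using val[OF y] wt[OF y] by simp
      then show False using h fin by auto
    qed
    then show "t \<in> Ropen G" using zero by blast
  next
    assume "t \<in> Ropen G"
    then have D: "zero_hedges G t = {}" using zero by simp
    have "w y = 0 \<and> valence K y = 3" if y: "y \<in> verts K" for y
    proof -
      obtain v where "v \<in> verts G" "s v = y" using y unfolding c(3)[symmetric] by blast
      \<comment> \<open>With nothing contracted the weight is one minus this cardinality, so a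
        nonempty fibre has one vertex and \<open>y\<close> has weight zero.\<close>
      then have "0 < card {u \<in> verts G. s u = y}"
        using pregraphD(1)[OF g(2)] by (auto simp: card_gt_0_iff)
      then show ?thesis using val[OF y] wt[OF y] D by simp
    qed
    then show "regular (curve_at (G, t))"
      by (simp add: K regular_def pure_def three_regular_def)
  qed
qed

text \<open>Near \<open>t\<close> the zero set can only shrink, so a nearby curve contracts onto the
  curve at \<open>t\<close>, and weight zero passes from the target of a contraction to its
  source.\<close>

lemma pure_curve_at_open:
  assumes G: "pregraph G" and t: "t \<in> topspace (Rbar G)" and pure: "pure (curve_at (G, t))"
  shows "\<exists>T. openin (Rbar G) T \<and> t \<in> T \<and> (\<forall>t'\<in>T. pure (curve_at (G, t')))"
proof (intro exI conjI ballI)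
  \<comment> \<open>Positive lengths are kept positive; zero lengths may move freely.\<close>
  define W where "W e = (if t e = 0 then UNIV else {0 <..} :: real set)" for e
  let ?T = "{t' \<in> topspace (Rbar G). \<forall>e\<in>edges G. t' e \<in> W e}"
  show "openin (Rbar G) ?T"
    by (rule openin_Rbar_box[OF finite_edges[OF G]]) (simp add: W_def)
  show "t \<in> ?T" using t by (auto simp: W_def topspace_Rbar PiE_iff order_less_le)
  fix t' assume t': "t' \<in> ?T"
  obtain K w l where K: "curve_at (G, t) = (K, w, l)" using prod_cases3 by blast
  obtain K' w' l' where K': "curve_at (G, t') = (K', w', l')" using prod_cases3 by blast
  obtain s where s: "contraction s (\<lambda>h. h) (zero_hedges G t) G (\<lambda>_. 0) K w" "l = t"
    using curve_at_contraction[OF G K] .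
  obtain s' where s': "contraction s' (\<lambda>h. h) (zero_hedges G t') G (\<lambda>_. 0) K' w'" "l' = t'"
    using curve_at_contraction[OF G K'] .
  have "zero_hedges G t' \<subseteq> zero_hedges G t"
  proof
    fix h assume h: "h \<in> zero_hedges G t'"
    then have "{h, opp G h} \<in> edges G" by (simp add: zero_hedges_def pair_in_edges_iff)
    then have "t' {h, opp G h} \<in> W {h, opp G h}" using t' by blast
    then show "h \<in> zero_hedges G t" using h by (auto simp: zero_hedges_def W_def split: if_splits)
  qed
  then obtain f a where f: "contraction f a ((\<lambda>h. h) ` (zero_hedges G t - zero_hedges G t')) K' w' K w"
    by (rule contraction_factor[OF s'(1) s(1)])
  have "w' v = 0" if v: "v \<in> verts K'" for v
    using contraction_weight_zero[OF f v] contractionD(11)[OF f v] pure by (simp add: K pure_def)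
  then show "pure (curve_at (G, t'))" by (simp add: K' pure_def)
qed

section \<open>Neighbourhoods of a curve and their separation\<close>

text \<open>\<open>D\<close> need not be the zero set of \<open>t\<close>: its edges are only short
  at the point. Quantifying over the contraction takes in every way in which \<open>G\<close>
  degenerates to the given graph.\<close>

definition nbhd :: "('v, 'h) lgraph set \<Rightarrow> ('w, 'k) tcurve \<Rightarrow> real \<Rightarrow> ('v, 'h) mpoint set" where
  "nbhd Gs = (\<lambda>(G', w', l') \<epsilon>. {(G, t). G \<in> Gs \<and> t \<in> topspace (Rbar G) \<and>
     (\<exists>D f a. contraction f a D G (\<lambda>_. 0) G' w' \<and>
        (\<forall>e\<in>edges G. \<bar>t e - pulled_length D a l' e\<bar> < \<epsilon>))})"

lemma nbhd_iff:
  "(G, t) \<in> nbhd Gs (G', w', l') \<epsilon> \<longleftrightarrow> G \<in> Gs \<and> t \<in> topspace (Rbar G) \<and>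
     (\<exists>D f a. contraction f a D G (\<lambda>_. 0) G' w' \<and>
        (\<forall>e\<in>edges G. \<bar>t e - pulled_length D a l' e\<bar> < \<epsilon>))"
  by (simp add: nbhd_def)

text \<open>Within a cell, a fixed contraction cuts out an open box around the pulled back lengths,
  and the neighbourhood is a union of such boxes.\<close>

lemma openin_nbhd:
  assumes "Gs \<subseteq> cubic_graphs g n"
  shows "openin (Mspace Gs) (nbhd Gs C \<epsilon>)"
proof (rule openin_Mspace)
  obtain G' w' l' where C: "C = (G', w', l')" using prod_cases3 by blast
  show "nbhd Gs C \<epsilon> \<subseteq> topspace (Mspace Gs)"
    by (auto simp: nbhd_def topspace_Mspace split: prod.splits)
  fix G t assume "(G, t) \<in> nbhd Gs C \<epsilon>"
  then obtain D f a where G: "G \<in> Gs" and t: "t \<in> topspace (Rbar G)"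
    and c: "contraction f a D G (\<lambda>_. 0) G' w'"
    and d: "\<forall>e\<in>edges G. \<bar>t e - pulled_length D a l' e\<bar> < \<epsilon>"
    unfolding C nbhd_iff by auto
  let ?T = "{t \<in> topspace (Rbar G). \<forall>e\<in>edges G. t e \<in> ball (pulled_length D a l' e) \<epsilon>}"
  have "openin (Rbar G) ?T"
    by (rule openin_Rbar_box[OF finite_edges[OF contractionD(1)[OF c]]]) simp
  moreover have "t \<in> ?T" using t d by (simp add: dist_real_def abs_minus_commute)
  moreover have "(G, t') \<in> nbhd Gs C \<epsilon>" if "t' \<in> ?T" for t'
  proof -
    have "\<forall>e\<in>edges G. \<bar>t' e - pulled_length D a l' e\<bar> < \<epsilon>"
      using that by (simp add: dist_real_def abs_minus_commute)
    then show ?thesis using that G c unfolding C nbhd_iff by blast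
  qed
  ultimately show "\<exists>T. openin (Rbar G) T \<and> t \<in> T \<and> (\<forall>t'\<in>T. (G, t') \<in> nbhd Gs C \<epsilon>)" by blast
qed

lemma curve_at_in_nbhd:
  assumes "Gs \<subseteq> cubic_graphs g n" "(G, t) \<in> topspace (Mspace Gs)" "0 < \<epsilon>"
  shows "(G, t) \<in> nbhd Gs (curve_at (G, t)) \<epsilon>"
proof -
  have G: "pregraph G" "G \<in> Gs" "t \<in> topspace (Rbar G)"
    using assms cubic_graphsD(2) by (auto simp: topspace_Mspace)
  obtain K w l where K: "curve_at (G, t) = (K, w, l)" using prod_cases3 by blast
  obtain s where s: "contraction s (\<lambda>h. h) (zero_hedges G t) G (\<lambda>_. 0) K w" "l = t"
    using curve_at_contraction[OF G(1) K] .
  have "pulled_length (zero_hedges G t) (\<lambda>h. h) t e = t e" if "e \<in> edges G" for e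
    using that by (auto simp: edges_def pulled_length_def zero_hedges_def)
  then show ?thesis using s G assms(3) unfolding K nbhd_iff by fastforce
qed

text \<open>Both points have the curve on \<open>K\<close> up to isomorphism. The contraction of
  \<open>G\<close> to \<open>G'\<close> factors through \<open>K\<close>; composing this factor with
  the contraction of \<open>H\<close> onto \<open>K\<close> yields the one required at
  \<open>y\<close>.\<close>

lemma nbhd_saturated:
  assumes Gs: "Gs \<subseteq> cubic_graphs g n" and "0 < \<epsilon>" and \<epsilon>: "\<And>e. e \<in> edges G' \<Longrightarrow> \<epsilon> \<le> l' e"
    and x: "x \<in> nbhd Gs (G', w', l') \<epsilon>" and xy: "(x, y) \<in> Mrel Gs"
  shows "y \<in> nbhd Gs (G', w', l') \<epsilon>"
proof -
  obtain G t H r where xy_eq: "x = (G, t)" "y = (H, r)" by (cases x; cases y) blast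
  obtain D f a where c: "contraction f a D G (\<lambda>_. 0) G' w'"
    and d: "\<And>e. e \<in> edges G \<Longrightarrow> \<bar>t e - pulled_length D a l' e\<bar> < \<epsilon>"
    using x unfolding xy_eq nbhd_iff by auto
  have H: "H \<in> Gs" "r \<in> topspace (Rbar H)" "pregraph H"
    using xy Gs cubic_graphsD(2) by (auto simp: Mrel_def xy_eq topspace_Mspace)
  note cD = contractionD[OF c]
  have len: "pulled_length D a l' {h, opp G h} = (if h \<in> D then 0 else l' (a ` {h, opp G h}))"
    if "h \<in> hedges G" for h using pulled_length_pair[OF cD(2,1) that] .
  have dh: "\<bar>t {h, opp G h} - pulled_length D a l' {h, opp G h}\<bar> < \<epsilon>"
    if "h \<in> hedges G" "opp G h \<noteq> h" for h
    using that d by (simp add: pair_in_edges_iff)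
  obtain K w l where K: "curve_at (H, r) = (K, w, l)" using prod_cases3 by blast
  obtain s where s: "contraction s (\<lambda>h. h) (zero_hedges H r) H (\<lambda>_. 0) K w" "l = r"
    using curve_at_contraction[OF H(3) K] .
  have "tcurve_iso (curve_at (G, t)) (K, w, r)" using xy by (simp add: Mrel_def xy_eq K s(2))
  then obtain p b where p: "contraction p b (zero_hedges G t) G (\<lambda>_. 0) K w"
    and r: "\<And>h. h \<in> hedges G - zero_hedges G t \<Longrightarrow> opp G h \<noteq> h \<Longrightarrow> r (b ` {h, opp G h}) = t {h, opp G h}"
    unfolding curve_at_iso_iff[OF cD(1)] by blast
  note pD = contractionD[OF p]
  \<comment> \<open>An edge of length zero outside \<open>D\<close> would give an edge of
    \<open>G'\<close> shorter than \<epsilon>.\<close>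
  have ZD: "zero_hedges G t \<subseteq> D"
  proof
    fix h assume h: "h \<in> zero_hedges G t"
    then have h': "h \<in> hedges G" "opp G h \<noteq> h" "t {h, opp G h} = 0" by (auto simp: zero_hedges_def)
    show "h \<in> D"
    proof (rule ccontr)
      assume "h \<notin> D"
      then have "a ` {h, opp G h} \<in> edges G'" "\<bar>0 - l' (a ` {h, opp G h})\<bar> < \<epsilon>"
        using h' dh[OF h'(1,2)] len[OF h'(1)] unfolding contraction_edges[OF c] by auto
      then show False using \<epsilon> by fastforce
    qed
  qed
  obtain f' a' where f': "contraction f' a' (b ` (D - zero_hedges G t)) K w G' w'"
    and a': "\<And>h. h \<in> hedges G - D \<Longrightarrow> a' (b h) = a h"
    by (rule contraction_factor[OF p c ZD]) blast
  \<comment> \<open>The edges of \<open>H\<close> of length zero, together with those that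
    correspond under \<open>b\<close> to positive edges of \<open>G\<close> in
    \<open>D\<close>.\<close>
  let ?D = "zero_hedges H r \<union> {h \<in> hedges H - zero_hedges H r. h \<in> b ` (D - zero_hedges G t)}"
  have q: "contraction (f' \<circ> s) a' ?D H (\<lambda>_. 0) G' w'"
    using contraction_comp[OF s(1) f'] by (simp add: comp_def)
  note qD = contractionD[OF q]
  have "\<bar>r e - pulled_length ?D a' l' e\<bar> < \<epsilon>" if e: "e \<in> edges H" for e
  proof -
    obtain k where k: "k \<in> hedges H" "opp H k \<noteq> k" "e = {k, opp H k}"
      using e by (auto simp: edges_def)
    have len': "pulled_length ?D a' l' e = (if k \<in> ?D then 0 else l' (a' ` {k, opp H k}))"
      unfolding k(3) by (rule pulled_length_pair[OF qD(2,1) k(1)])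
    show ?thesis
    proof (cases "k \<in> zero_hedges H r")
      case True
      then have "r e = 0" by (simp add: zero_hedges_def k(3))
      then show ?thesis using len' True \<open>0 < \<epsilon>\<close> by simp
    next
      case False
      then have kK: "k \<in> hedges H - zero_hedges H r" using k(1) by simp
      then have "k \<in> hedges K" using contractionD(10)[OF s(1)] by simp
      then have "k \<in> b ` (hedges G - zero_hedges G t)" using pD(5) by (simp add: bij_betw_def)
      then obtain h where h: "h \<in> hedges G - zero_hedges G t" "k = b h" by blast
      have oppk: "opp H k = b (opp G h)"
        using contractionD(6)[OF s(1) kK] pD(6)[OF h(1)] h(2) by simp
      then have hh: "opp G h \<noteq> h" using k(2) h(2) by auto
      have e_eq: "e = b ` {h, opp G h}" using k(3) h(2) oppk by simp
      have re: "r e = t {h, opp G h}" unfolding e_eq by (rule r[OF h(1) hh])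
      have inj: "inj_on b (hedges G - zero_hedges G t)" using pD(5) by (simp add: bij_betw_def)
      have "D - zero_hedges G t \<subseteq> hedges G - zero_hedges G t"
        using cD(2) by (auto simp: edge_closed_def)
      then have kD: "k \<in> b ` (D - zero_hedges G t) \<longleftrightarrow> h \<in> D"
        using inj_on_image_mem_iff[OF inj h(1)] h by simp
      have "a' ` {k, opp H k} = a ` {h, opp G h}" if "h \<notin> D"
      proof -
        have "h \<in> hedges G - D" using h(1) that by simp
        then show ?thesis
          using a' edge_closed_opp_notin[OF cD(1,2)] h(2) oppk by simp
      qed
      then have "pulled_length ?D a' l' e = pulled_length D a l' {h, opp G h}"
        using len' kD kK len[of h] h(1) by simp
      then show ?thesis using re dh[OF _ hh] h(1) by simp
    qed
  qed
  then show ?thesis using q H(1,2) unfolding xy_eq nbhd_iff by blast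
qed

text \<open>At a common point the contracted edges are those shorter than \<epsilon>, so both
  contractions have the same \<open>D\<close>, and factoring one through the other contracts
  nothing. Matching lengths are within \<epsilon> of the same number, hence equal by the gap
  condition.\<close>

lemma nbhd_disjoint:
  assumes \<epsilon>1: "\<And>e. e \<in> edges G1 \<Longrightarrow> 2 * \<epsilon> \<le> l1 e" and \<epsilon>2: "\<And>e. e \<in> edges G2 \<Longrightarrow> 2 * \<epsilon> \<le> l2 e"
    and sep: "\<And>e e'. e \<in> edges G1 \<Longrightarrow> e' \<in> edges G2 \<Longrightarrow> l1 e \<noteq> l2 e' \<Longrightarrow> 2 * \<epsilon> \<le> \<bar>l1 e - l2 e'\<bar>"
    and x: "x \<in> nbhd Gs (G1, w1, l1) \<epsilon>" "x \<in> nbhd Gs (G2, w2, l2) \<epsilon>"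
  shows "tcurve_iso (G1, w1, l1) (G2, w2, l2)"
proof -
  obtain G t where x_eq: "x = (G, t)" by fastforce
  obtain D1 f1 a1 where c1: "contraction f1 a1 D1 G (\<lambda>_. 0) G1 w1"
    and d1: "\<And>e. e \<in> edges G \<Longrightarrow> \<bar>t e - pulled_length D1 a1 l1 e\<bar> < \<epsilon>"
    using x(1) unfolding x_eq nbhd_iff by auto
  obtain D2 f2 a2 where c2: "contraction f2 a2 D2 G (\<lambda>_. 0) G2 w2"
    and d2: "\<And>e. e \<in> edges G \<Longrightarrow> \<bar>t e - pulled_length D2 a2 l2 e\<bar> < \<epsilon>"
    using x(2) unfolding x_eq nbhd_iff by auto
  \<comment> \<open>Generic in the types of the target, because \<open>G1\<close> and
    \<open>G2\<close> may live on different ones.\<close>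
  have small: "h \<in> D \<longleftrightarrow> t {h, opp G h} < \<epsilon>"
    if c: "contraction f a D G (\<lambda>_. 0) G' w'" and \<epsilon>: "\<And>e. e \<in> edges G' \<Longrightarrow> 2 * \<epsilon> \<le> l e"
      and d: "\<And>e. e \<in> edges G \<Longrightarrow> \<bar>t e - pulled_length D a l e\<bar> < \<epsilon>"
      and h: "h \<in> hedges G" "opp G h \<noteq> h"
    for f :: "_ \<Rightarrow> 'z" and a :: "_ \<Rightarrow> 'y" and D G' w' l h
  proof -
    note cD = contractionD[OF c]
    have "\<bar>t {h, opp G h} - (if h \<in> D then 0 else l (a ` {h, opp G h}))\<bar> < \<epsilon>"
      using d[of "{h, opp G h}"] pulled_length_pair[OF cD(2,1) h(1), of a l] h
      by (simp add: pair_in_edges_iff)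
    moreover have "2 * \<epsilon> \<le> l (a ` {h, opp G h})" if "h \<notin> D"
      using that h by (intro \<epsilon>) (auto simp only: contraction_edges[OF c] Diff_iff mem_Collect_eq)
    ultimately show ?thesis by (cases "h \<in> D") (simp_all add: abs_if split: if_splits)
  qed
  have D: "D1 = D2"
  proof -
    have "h \<in> D1 \<longleftrightarrow> h \<in> D2" if "h \<in> hedges G" "opp G h \<noteq> h" for h
      using small[OF c1 \<epsilon>1 d1 that] small[OF c2 \<epsilon>2 d2 that] by simp
    then show ?thesis using contractionD(2)[OF c1] contractionD(2)[OF c2]
      by (auto simp: edge_closed_def)
  qed
  obtain f a where c: "contraction f a (a1 ` (D2 - D1)) G1 w1 G2 w2"
    and a: "\<And>h. h \<in> hedges G - D2 \<Longrightarrow> a (a1 h) = a2 h"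
    using contraction_factor[OF c1 c2] D by blast
  have "l2 (a ` e) = l1 e" if e: "e \<in> edges G1" for e
  proof -
    obtain h where h: "e = a1 ` {h, opp G h}" "h \<in> hedges G - D1" "opp G h \<noteq> h"
      using e unfolding contraction_edges[OF c1] by blast
    have h2: "h \<in> hedges G - D2" using h(2) D by simp
    have ae: "a ` e = a2 ` {h, opp G h}"
      using a[OF h2] a[OF edge_closed_opp_notin[OF contractionD(1,2)[OF c2] h2]] h(1) by simp
    have "{h, opp G h} \<in> edges G" using h by (simp add: pair_in_edges_iff)
    then have "\<bar>t {h, opp G h} - l1 e\<bar> < \<epsilon>" "\<bar>t {h, opp G h} - l2 (a ` e)\<bar> < \<epsilon>"
      using d1 d2 pulled_length_pair[OF contractionD(2,1)[OF c1], of h a1 l1]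
        pulled_length_pair[OF contractionD(2,1)[OF c2], of h a2 l2] h(2) h2
      unfolding ae by (force simp: h(1))+
    then have "\<bar>l1 e - l2 (a ` e)\<bar> < 2 * \<epsilon>" by linarith
    moreover have "a ` e \<in> edges G2" unfolding ae contraction_edges[OF c2] using h2 h(3) by blast
    ultimately show ?thesis using sep[OF e, of "a ` e"] by force
  qed
  then show ?thesis
    unfolding tcurve_iso_iff[OF contraction_pregraph[OF c1]] using c D by auto
qed

text \<open>The fibres of an isomorphism are single vertices, so \<open>contraction_valence\<close>
  preserves valences.\<close>

lemma tcurve_iso_regular:
  assumes C: "C \<in> tcurves g n" and CC': "tcurve_iso C C'" and "regular C"
  shows "regular C'"
proof -
  obtain G w l G' w' l' where eq: "C = (G, w, l)" "C' = (G', w', l')" by (cases C; cases C') blast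
  have G: "pregraph G" and reg: "regular (G, w, l)" and iso: "tcurve_iso (G, w, l) (G', w', l')"
    using assms tcurves_pregraph by (auto simp: eq)
  obtain f a where c: "contraction f a {} G w G' w'"
    using iso by (auto simp: tcurve_iso_iff[OF G])
  have "valence G' y = 3" if y: "y \<in> verts G'" for y
  proof -
    obtain v where v: "v \<in> verts G" "f v = y" using y unfolding contractionD(3)[OF c, symmetric] by blast
    have "{u. u \<in> verts G \<and> f u = y} = {v}"
      using v contractionD(4)[OF c] by (auto simp: hadj_def)
    then show ?thesis
      using contraction_valence[OF c y] reg v by (simp add: regular_def three_regular_def)
  qed
  then show ?thesis
    using tcurve_iso_pure[OF iso] reg by (simp add: eq regular_def three_regular_def)
qed

lemma finite_positive_bound:
  fixes A :: "real set"
  assumes "finite A" "\<And>x. x \<in> A \<Longrightarrow> 0 < x"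
  shows "\<exists>\<delta>>0. \<forall>x\<in>A. \<delta> \<le> x"
  \<comment> \<open>Inserting \<open>1\<close> keeps the minimum defined when \<open>A\<close> is
    empty, as happens for curves without edges.\<close>
  using assms by (intro exI[of _ "Min (insert 1 A)"]) auto

section \<open>The moduli space for a fixed choice of representatives: points and classes\<close>

context
  fixes g n :: nat and Gs :: "(nat, nat) lgraph set"
  assumes reps: "cubic_representatives g n Gs"
begin

lemma Gs_cubic: "Gs \<subseteq> cubic_graphs g n"
  using reps by (simp add: cubic_representatives_def)

lemmas Mrel_equiv = equiv_Mrel[OF Gs_cubic]
lemmas point_tcurve = curve_at_in_tcurves[OF Gs_cubic]

lemma topspace_Mtrop: "topspace (Mtrop Gs) = (\<lambda>x. Mrel Gs `` {x}) ` topspace (Mspace Gs)"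
  by (auto simp: Mtrop_def quotient_def)

lemma Mrel_class_eq_iff:
  assumes "x \<in> topspace (Mspace Gs)" "y \<in> topspace (Mspace Gs)"
  shows "Mrel Gs `` {x} = Mrel Gs `` {y} \<longleftrightarrow> tcurve_iso (curve_at x) (curve_at y)"
  using eq_equiv_class_iff[OF Mrel_equiv assms] assms by (simp add: Mrel_def)

text \<open>The graph is expanded to a cubic one, which is replaced by its representative; pulling
  the lengths back gives the point.\<close>

lemma exists_point:
  assumes "(C :: (nat, nat) tcurve) \<in> tcurves g n"
  shows "\<exists>x\<in>topspace (Mspace Gs). tcurve_iso (curve_at x) C"
proof -
  obtain G w l where C: "C = (G, w, l)" using prod_cases3 by blast
  have G: "is_lgraph G" "pregraph G" "stable G w" "genus G w = g" "card (legs G) = n"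
    and l: "\<And>e. e \<in> edges G \<Longrightarrow> 0 < l e"
    using assms by (auto simp: C tcurves_def is_lgraph_iff)
  obtain G' :: "(nat, nat) lgraph" and f a D where
    c: "contraction f a D G' (\<lambda>_. 0) G w" and three: "three_regular G'"
    using exists_cubic_expansion[OF G(2,3)] by blast
  have G': "is_lgraph G'" using contraction_is_lgraph_iff[OF c] G(1) by simp
  moreover have "betti1 G' = g" using contraction_genus[OF c G'] G(4) by (simp add: genus_def)
  ultimately have "G' \<in> cubic_graphs g n"
    using three contraction_legs(2)[OF c] G(5) by (simp add: cubic_graphs_def)
  then obtain H where H: "H \<in> Gs" "lgraph_iso G' H"
    using reps unfolding cubic_representatives_def by blast
  have HG: "pregraph H" using H(1) Gs_cubic cubic_graphsD(2) by blast
  obtain p b where "lgraph_iso_by p b H G'"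
    using lgraph_iso_sym[OF G' H(2)] by (auto simp: lgraph_iso_def)
  then have "contraction p b {} H (\<lambda>_. 0) G' (\<lambda>_. 0)" by (simp add: contraction_empty_iff[OF HG])
  from contraction_comp[OF this c] obtain f' a' D' where
    c': "contraction f' a' D' H (\<lambda>_. 0) G w" by blast
  \<comment> \<open>Points of the product topology are extensional, hence the restriction to the
    edges.\<close>
  define t where "t = restrict (pulled_length D' a' l) (edges H)"
  have "tcurve_iso (curve_at (H, t)) C"
    unfolding C by (rule curve_at_pulled_length[OF c' l]) (simp_all add: t_def)
  moreover have "0 \<le> pulled_length D' a' l e" if e: "e \<in> edges H" for e
  proof -
    obtain h where h: "e = {h, opp H h}" "h \<in> hedges H" "opp H h \<noteq> h" using e by (auto simp: edges_def)
    have "0 < l (a' ` {h, opp H h})" if "h \<notin> D'"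
      using that h by (intro l) (auto simp only: contraction_edges[OF c'] Diff_iff mem_Collect_eq)
    then show ?thesis
      unfolding h(1) pulled_length_pair[OF contractionD(2,1)[OF c'] h(2)] by (simp add: less_imp_le)
  qed
  then have "(H, t) \<in> topspace (Mspace Gs)"
    using H(1) by (simp add: topspace_Mspace topspace_Rbar t_def)
  ultimately show ?thesis by blast
qed

text \<open>The class attached to a point becomes an ordinary equivalence class, so that both halves
  of the bijection follow from facts on quotients.\<close>

lemma class_at_eq:
  assumes x: "x \<in> topspace (Mspace Gs)" and C: "(C :: (nat, nat) tcurve) \<in> tcurves g n"
    and xC: "tcurve_iso (curve_at x) C"
  shows "class_at g n (Mrel Gs `` {x}) =
    {(C, D :: (nat, nat) tcurve). C \<in> tcurves g n \<and> D \<in> tcurves g n \<and> tcurve_iso C D} `` {C}"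
proof (intro subset_antisym subsetI)
  have Cx: "tcurve_iso C (curve_at x)" using tcurves_iso_sym[OF point_tcurve[OF x] xC] .
  fix D :: "(nat, nat) tcurve"
  assume "D \<in> class_at g n (Mrel Gs `` {x})"
  then obtain y where "y \<in> topspace (Mspace Gs)" "D \<in> tcurves g n" 
    "tcurve_iso (curve_at x) (curve_at y)" "tcurve_iso (curve_at y) D"
    by (auto simp: class_at_def Mrel_def)
  then show "D \<in> {(C, D). C \<in> tcurves g n \<and> D \<in> tcurves g n \<and> tcurve_iso C D} `` {C}"
    using C tcurves_iso_trans[OF C Cx] tcurves_iso_trans[OF C] by blast
next
  fix D :: "(nat, nat) tcurve"
  assume "D \<in> {(C, D). C \<in> tcurves g n \<and> D \<in> tcurves g n \<and> tcurve_iso C D} `` {C}"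
  then have "D \<in> tcurves g n" "tcurve_iso C D" by auto
  moreover then have "tcurve_iso (curve_at x) D"
    using tcurves_iso_trans[OF point_tcurve[OF x] xC] by blast
  moreover have "x \<in> Mrel Gs `` {x}" using equiv_class_self[OF Mrel_equiv x] .
  ultimately show "D \<in> class_at g n (Mrel Gs `` {x})" by (auto simp: class_at_def)
qed

lemma point_nat_copy:
  assumes "x \<in> topspace (Mspace Gs)"
  obtains C :: "(nat, nat) tcurve" where "C \<in> tcurves g n" "tcurve_iso (curve_at x) C"
  using tcurve_nat_copy[OF point_tcurve[OF assms]] by blast

text \<open>Injectivity goes through copies on natural numbers, since the curves at points are not
  themselves members of the classes. Surjectivity is \<open>exists_point\<close>.\<close>

lemma class_at_bij:
  "bij_betw (class_at g n) (topspace (Mtrop Gs)) (tcurve_classes g n :: (nat, nat) tcurve set set)"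
  unfolding bij_betw_def
proof
  let ?R = "{(C :: (nat, nat) tcurve, D :: (nat, nat) tcurve).
    C \<in> tcurves g n \<and> D \<in> tcurves g n \<and> tcurve_iso C D}"
  show "inj_on (class_at g n :: _ \<Rightarrow> (nat, nat) tcurve set) (topspace (Mtrop Gs))"
  proof (rule inj_onI)
    fix X Y assume XY: "X \<in> topspace (Mtrop Gs)" "Y \<in> topspace (Mtrop Gs)"
      "(class_at g n X :: (nat, nat) tcurve set) = class_at g n Y"
    obtain x where x: "x \<in> topspace (Mspace Gs)" "X = Mrel Gs `` {x}" using XY(1) unfolding topspace_Mtrop by blast
    obtain y where y: "y \<in> topspace (Mspace Gs)" "Y = Mrel Gs `` {y}" using XY(2) unfolding topspace_Mtrop by blast
    obtain C :: "(nat, nat) tcurve" where C: "C \<in> tcurves g n" "tcurve_iso (curve_at x) C"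
      using point_nat_copy[OF x(1)] .
    obtain D :: "(nat, nat) tcurve" where D: "D \<in> tcurves g n" "tcurve_iso (curve_at y) D"
      using point_nat_copy[OF y(1)] .
    have "?R `` {C} = ?R `` {D}"
      using XY(3) unfolding x(2) y(2) class_at_eq[OF x(1) C] class_at_eq[OF y(1) D] .
    then have "tcurve_iso C D" using eq_equiv_class[OF _ equiv_tcurves D(1)] by blast
    then have "tcurve_iso (curve_at x) D" using tcurves_iso_trans[OF point_tcurve[OF x(1)] C(2)] by blast
    then have "tcurve_iso (curve_at x) (curve_at y)"
      using tcurves_iso_trans[OF point_tcurve[OF x(1)]] tcurves_iso_sym[OF point_tcurve[OF y(1)] D(2)] by blast
    then show "X = Y" unfolding x(2) y(2) Mrel_class_eq_iff[OF x(1) y(1)] .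
  qed
  show "class_at g n ` topspace (Mtrop Gs) = (tcurve_classes g n :: (nat, nat) tcurve set set)"
  proof (intro subset_antisym subsetI)
    fix A :: "(nat, nat) tcurve set"
    assume "A \<in> class_at g n ` topspace (Mtrop Gs)"
    then obtain x where x: "x \<in> topspace (Mspace Gs)" "A = class_at g n (Mrel Gs `` {x})"
      unfolding topspace_Mtrop by blast
    obtain C :: "(nat, nat) tcurve" where C: "C \<in> tcurves g n" "tcurve_iso (curve_at x) C"
      using point_nat_copy[OF x(1)] .
    show "A \<in> tcurve_classes g n"
      unfolding tcurve_classes_def x(2) class_at_eq[OF x(1) C] by (rule quotientI[OF C(1)])
  next
    fix A :: "(nat, nat) tcurve set"
    assume "A \<in> tcurve_classes g n"
    then obtain C where C: "C \<in> tcurves g n" "A = ?R `` {C}"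
      unfolding tcurve_classes_def by (rule quotientE)
    obtain x where x: "x \<in> topspace (Mspace Gs)" "tcurve_iso (curve_at x) C"
      using exists_point[OF C(1)] by blast
    have "A = class_at g n (Mrel Gs `` {x})" unfolding C(2) class_at_eq[OF x(1) C(1) x(2)] ..
    then show "A \<in> class_at g n ` topspace (Mtrop Gs)" unfolding topspace_Mtrop using x(1) by blast
  qed
qed

section \<open>The open dense loci and the decomposition into cells\<close>

lemma open_cells_subset: "{(G, t). G \<in> Gs \<and> t \<in> Ropen G} \<subseteq> topspace (Mspace Gs)"
  by (auto simp: topspace_Mspace Ropen_def)

lemma regular_point_iff:
  assumes "(G, t) \<in> topspace (Mspace Gs)"
  shows "regular (curve_at (G, t)) \<longleftrightarrow> G \<in> Gs \<and> t \<in> Ropen G"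
proof -
  have G: "G \<in> Gs" "t \<in> topspace (Rbar G)" using assms by (simp_all add: topspace_Mspace)
  show ?thesis using regular_curve_at_iff[OF subsetD[OF Gs_cubic G(1)] G(2)] G(1) by simp
qed

text \<open>A class with a regular member is the class of that member, which lies in an open cell by
  \<open>regular_point_iff\<close>.\<close>

lemma Mreg_eq_image: "Mreg Gs = (\<lambda>x. Mrel Gs `` {x}) ` {(G, t). G \<in> Gs \<and> t \<in> Ropen G}"
proof (intro subset_antisym subsetI)
  fix X assume "X \<in> Mreg Gs"
  then obtain x y where x: "x \<in> X" "regular (curve_at x)"
    and y: "y \<in> topspace (Mspace Gs)" "X = Mrel Gs `` {y}"
    unfolding Mreg_def topspace_Mtrop by blast
  have yx: "(y, x) \<in> Mrel Gs" using x y by blast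
  then have "X = Mrel Gs `` {x}" using equiv_class_eq[OF Mrel_equiv yx] y(2) by simp
  moreover have "x \<in> topspace (Mspace Gs)" using yx by (simp add: Mrel_def)
  then have "x \<in> {(G, t). G \<in> Gs \<and> t \<in> Ropen G}"
    using x(2) regular_point_iff by (cases x) blast
  ultimately show "X \<in> (\<lambda>x. Mrel Gs `` {x}) ` {(G, t). G \<in> Gs \<and> t \<in> Ropen G}" by blast
next
  fix X assume "X \<in> (\<lambda>x. Mrel Gs `` {x}) ` {(G, t). G \<in> Gs \<and> t \<in> Ropen G}"
  then obtain G t where Gt: "G \<in> Gs" "t \<in> Ropen G" "X = Mrel Gs `` {(G, t)}" by blast
  have p: "(G, t) \<in> topspace (Mspace Gs)" using Gt(1,2) open_cells_subset by blast
  have "(G, t) \<in> X" unfolding Gt(3) by (rule equiv_class_self[OF Mrel_equiv p])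
  then show "X \<in> Mreg Gs"
    unfolding Mreg_def topspace_Mtrop using p Gt regular_point_iff[OF p] by blast
qed

lemma Mpure_eq_image:
  "Mpure Gs = (\<lambda>x. Mrel Gs `` {x}) ` {x \<in> topspace (Mspace Gs). pure (curve_at x)}"
proof (intro subset_antisym subsetI)
  fix X assume "X \<in> Mpure Gs"
  then obtain x y where x: "x \<in> X" "pure (curve_at x)"
    and y: "y \<in> topspace (Mspace Gs)" "X = Mrel Gs `` {y}"
    unfolding Mpure_def topspace_Mtrop by blast
  have yx: "(y, x) \<in> Mrel Gs" using x y by blast
  then have "X = Mrel Gs `` {x}" using equiv_class_eq[OF Mrel_equiv yx] y(2) by simp
  moreover have "x \<in> topspace (Mspace Gs)" using yx by (simp add: Mrel_def)
  ultimately show "X \<in> (\<lambda>x. Mrel Gs `` {x}) ` {x \<in> topspace (Mspace Gs). pure (curve_at x)}"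
    using x(2) by blast
next
  fix X assume "X \<in> (\<lambda>x. Mrel Gs `` {x}) ` {x \<in> topspace (Mspace Gs). pure (curve_at x)}"
  then obtain x where x: "x \<in> topspace (Mspace Gs)" "pure (curve_at x)" "X = Mrel Gs `` {x}" by blast
  then show "X \<in> Mpure Gs"
    unfolding Mpure_def topspace_Mtrop using equiv_class_self[OF Mrel_equiv x(1)] by blast
qed

text \<open>The union of the open cells is open, and it is saturated because regularity is invariant
  under isomorphism.\<close>

lemma openin_Mreg: "openin (Mtrop Gs) (Mreg Gs)"
  unfolding Mreg_eq_image Mtrop_def
proof (rule openin_quotient_image[OF Mrel_equiv])
  show "openin (Mspace Gs) {(G, t). G \<in> Gs \<and> t \<in> Ropen G}"
  proof (rule openin_Mspace[OF open_cells_subset])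
    fix G t assume "(G, t) \<in> {(G, t). G \<in> Gs \<and> t \<in> Ropen G}"
    then have Gt: "G \<in> Gs" "t \<in> Ropen G" by auto
    have "finite (edges G)" using Gt(1) Gs_cubic cubic_graphsD(2) finite_edges by blast
    then have "openin (Rbar G) (Ropen G)" unfolding Ropen_eq by (intro openin_Rbar_box) auto
    then show "\<exists>T. openin (Rbar G) T \<and> t \<in> T \<and> (\<forall>t'\<in>T. (G, t') \<in> {(G, t). G \<in> Gs \<and> t \<in> Ropen G})"
      using Gt by blast
  qed
next
  fix x y assume x: "x \<in> {(G, t). G \<in> Gs \<and> t \<in> Ropen G}" and xy: "(x, y) \<in> Mrel Gs"
  have p: "x \<in> topspace (Mspace Gs)" "y \<in> topspace (Mspace Gs)" "tcurve_iso (curve_at x) (curve_at y)"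
    using xy by (auto simp: Mrel_def)
  have "regular (curve_at x)" using x p(1) regular_point_iff by (cases x) blast
  then have "regular (curve_at y)"
    by (rule tcurve_iso_regular[OF point_tcurve[OF p(1)] p(3)])
  then show "y \<in> {(G, t). G \<in> Gs \<and> t \<in> Ropen G}" using p(2) regular_point_iff by (cases y) blast
qed

lemma openin_Mpure: "openin (Mtrop Gs) (Mpure Gs)"
  unfolding Mpure_eq_image Mtrop_def
proof (rule openin_quotient_image[OF Mrel_equiv])
  show "openin (Mspace Gs) {x \<in> topspace (Mspace Gs). pure (curve_at x)}"
  proof (rule openin_Mspace)
    fix G t assume "(G, t) \<in> {x \<in> topspace (Mspace Gs). pure (curve_at x)}"
    then have Gt: "G \<in> Gs" "t \<in> topspace (Rbar G)" "pure (curve_at (G, t))"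
      by (auto simp: topspace_Mspace)
    have G: "pregraph G" using Gt(1) Gs_cubic cubic_graphsD(2) by blast
    obtain T where T: "openin (Rbar G) T" "t \<in> T" "\<forall>t'\<in>T. pure (curve_at (G, t'))"
      using pure_curve_at_open[OF G Gt(2,3)] by blast
    have "\<forall>t'\<in>T. (G, t') \<in> {x \<in> topspace (Mspace Gs). pure (curve_at x)}"
      using T Gt(1) openin_subset[OF T(1)] by (auto simp: topspace_Mspace)
    then show "\<exists>T. openin (Rbar G) T \<and> t \<in> T \<and>
        (\<forall>t'\<in>T. (G, t') \<in> {x \<in> topspace (Mspace Gs). pure (curve_at x)})"
      using T by blast
  qed simp
next
  fix x y assume x: "x \<in> {x \<in> topspace (Mspace Gs). pure (curve_at x)}" and xy: "(x, y) \<in> Mrel Gs"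
  have "tcurve_iso (curve_at x) (curve_at y)" "y \<in> topspace (Mspace Gs)"
    using xy by (auto simp: Mrel_def)
  then show "y \<in> {x \<in> topspace (Mspace Gs). pure (curve_at x)}"
    using x tcurve_iso_pure by blast
qed

lemma Mreg_dense: "Mtrop Gs closure_of Mreg Gs = topspace (Mtrop Gs)"
  unfolding Mreg_eq_image Mtrop_def by (rule closure_of_quotient_image[OF dense_open_cells])

lemma Mpure_dense: "Mtrop Gs closure_of Mpure Gs = topspace (Mtrop Gs)"
proof -
  have "pure C" if "regular C" for C :: "(nat set, nat) tcurve"
    using that by (cases C) (simp add: regular_def)
  then have "Mreg Gs \<subseteq> Mpure Gs" unfolding Mreg_def Mpure_def by blast
  then show ?thesis
    using Mreg_dense closure_of_mono closure_of_subset_topspace by (metis subset_antisym)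
qed

lemma Mreg_eq_Union: "Mreg Gs = (\<Union>G\<in>Gs. Mcell Gs G)"
  unfolding Mreg_eq_image Mcell_def by blast

text \<open>Even when nothing is contracted, the vertices of the curve at the point are singletons,
  so it is isomorphic to \<open>G\<close> with its metric and not equal to it.\<close>

lemma tcurve_iso_open_cell:
  assumes "G \<in> Gs" "t \<in> Ropen G"
  shows "tcurve_iso (curve_at (G, t)) (G, \<lambda>_. 0, t)"
proof -
  have G: "pregraph G" using assms(1) Gs_cubic cubic_graphsD(2) by blast
  have "zero_hedges G t = {}"
    using assms(2) unfolding Ropen_def ball_edges zero_hedges_def by auto
  then show ?thesis
    using contraction_refl[OF G, of "\<lambda>_. 0"] unfolding curve_at_iso_iff[OF G]
    by (intro exI[of _ "\<lambda>v. v"] exI[of _ "\<lambda>h. h"]) simp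
qed

text \<open>A common class gives an isomorphism of the two underlying graphs, against the uniqueness
  of representatives.\<close>

lemma Mcell_disjoint: "disjoint_family_on (Mcell Gs) Gs"
  unfolding disjoint_family_on_def
proof (intro ballI impI, rule ccontr)
  fix G H assume GH: "G \<in> Gs" "H \<in> Gs" "G \<noteq> H" "Mcell Gs G \<inter> Mcell Gs H \<noteq> {}"
  then obtain t r where t: "t \<in> Ropen G" and r: "r \<in> Ropen H"
    and eq: "Mrel Gs `` {(G, t)} = Mrel Gs `` {(H, r)}"
    unfolding Mcell_def by blast
  have p: "(G, t) \<in> topspace (Mspace Gs)" "(H, r) \<in> topspace (Mspace Gs)"
    using t r GH(1,2) open_cells_subset by blast+
  have "tcurve_iso (curve_at (G, t)) (curve_at (H, r))"
    using eq Mrel_class_eq_iff[OF p] by blast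
  then have 1: "tcurve_iso (curve_at (G, t)) (H, \<lambda>_. 0, r)"
    by (rule tcurves_iso_trans[OF point_tcurve[OF p(1)] _ tcurve_iso_open_cell[OF GH(2) r]])
  have 2: "tcurve_iso (G, \<lambda>_. 0, t) (curve_at (G, t))"
    by (rule tcurves_iso_sym[OF point_tcurve[OF p(1)] tcurve_iso_open_cell[OF GH(1) t]])
  have G: "G \<in> cubic_graphs g n" using GH(1) Gs_cubic by blast
  have "(G, \<lambda>_. 0, t) \<in> tcurves g n"
    using cubic_graphsD[OF G] t by (simp add: tcurves_def Ropen_def)
  then have "tcurve_iso (G, \<lambda>_. 0, t) (H, \<lambda>_. 0, r)" by (rule tcurves_iso_trans[OF _ 2 1])
  then have "lgraph_iso G H" by (auto simp: tcurve_iso_def lgraph_iso_def)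
  moreover have "\<exists>!G'. G' \<in> Gs \<and> lgraph_iso G G'"
    using reps G unfolding cubic_representatives_def by blast
  ultimately show False using GH lgraph_iso_refl by blast
qed

lemma Hausdorff_Mtrop: "Hausdorff_space (Mtrop Gs)"
  unfolding Hausdorff_space_def
proof (intro allI impI)
  fix X Y assume XY: "X \<in> topspace (Mtrop Gs) \<and> Y \<in> topspace (Mtrop Gs) \<and> X \<noteq> Y"
  let ?q = "\<lambda>x. Mrel Gs `` {x}"
  obtain x where x: "x \<in> topspace (Mspace Gs)" "X = ?q x" using XY unfolding topspace_Mtrop by blast
  obtain y where y: "y \<in> topspace (Mspace Gs)" "Y = ?q y" using XY unfolding topspace_Mtrop by blast
  have not_iso: "\<not> tcurve_iso (curve_at x) (curve_at y)"
    using XY Mrel_class_eq_iff[OF x(1) y(1)] x(2) y(2) by blast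
  obtain K w l where K: "curve_at x = (K, w, l)" using prod_cases3 by blast
  obtain K' w' l' where K': "curve_at y = (K', w', l')" using prod_cases3 by blast
  have KC: "(K, w, l) \<in> tcurves g n" and KC': "(K', w', l') \<in> tcurves g n"
    using point_tcurve[OF x(1)] point_tcurve[OF y(1)] by (simp_all add: K K')
  let ?E = "edges K" and ?E' = "edges K'"
  \<comment> \<open>Only nonzero differences are collected, so that finitely many positive numbers
    have to be bounded below.\<close>
  let ?gaps = "(\<lambda>(e, e'). \<bar>l e - l' e'\<bar>) ` {(e, e') \<in> ?E \<times> ?E'. l e \<noteq> l' e'}"
  have fin: "finite ?E" "finite ?E'"
    using finite_edges tcurves_pregraph[OF KC] tcurves_pregraph[OF KC'] by auto
  have "finite (l ` ?E \<union> l' ` ?E' \<union> ?gaps)"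
    using fin by (auto intro: finite_subset[of _ "?E \<times> ?E'"])
  moreover have "0 < z" if "z \<in> l ` ?E \<union> l' ` ?E' \<union> ?gaps" for z
    using that KC KC' by (auto simp: tcurves_def)
  ultimately obtain \<delta> where \<delta>: "0 < \<delta>" "\<forall>z\<in>l ` ?E \<union> l' ` ?E' \<union> ?gaps. \<delta> \<le> z"
    using finite_positive_bound by meson
  \<comment> \<open>Halving leaves room for two errors below \<epsilon>, one from each
    neighbourhood.\<close>
  define \<epsilon> where "\<epsilon> = \<delta> / 2"
  have \<epsilon>: "0 < \<epsilon>" "\<And>e. e \<in> ?E \<Longrightarrow> 2 * \<epsilon> \<le> l e" "\<And>e. e \<in> ?E' \<Longrightarrow> 2 * \<epsilon> \<le> l' e"
    "\<And>e e'. e \<in> ?E \<Longrightarrow> e' \<in> ?E' \<Longrightarrow> l e \<noteq> l' e' \<Longrightarrow> 2 * \<epsilon> \<le> \<bar>l e - l' e'\<bar>"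
    using \<delta> by (auto simp: \<epsilon>_def)
  have sat: "b \<in> nbhd Gs (K, w, l) \<epsilon>" if "a \<in> nbhd Gs (K, w, l) \<epsilon>" "(a, b) \<in> Mrel Gs" for a b
    by (rule nbhd_saturated[OF Gs_cubic \<epsilon>(1) _ that]) (use \<epsilon>(1,2) in force)
  have sat': "b \<in> nbhd Gs (K', w', l') \<epsilon>" if "a \<in> nbhd Gs (K', w', l') \<epsilon>" "(a, b) \<in> Mrel Gs" for a b
    by (rule nbhd_saturated[OF Gs_cubic \<epsilon>(1) _ that]) (use \<epsilon>(1,3) in force)
  let ?U = "?q ` nbhd Gs (K, w, l) \<epsilon>" and ?V = "?q ` nbhd Gs (K', w', l') \<epsilon>"
  have "openin (Mtrop Gs) ?U" "openin (Mtrop Gs) ?V"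
    unfolding Mtrop_def
    by (rule openin_quotient_image[OF Mrel_equiv openin_nbhd[OF Gs_cubic]], erule sat sat', assumption)+
  moreover have "x \<in> nbhd Gs (K, w, l) \<epsilon>" "y \<in> nbhd Gs (K', w', l') \<epsilon>"
    using curve_at_in_nbhd[OF Gs_cubic _ \<epsilon>(1)] x(1) y(1) by (metis K K' surj_pair)+
  then have "X \<in> ?U" "Y \<in> ?V" unfolding x(2) y(2) by blast+
  moreover have "disjnt ?U ?V"
  proof (rule ccontr)
    assume "\<not> disjnt ?U ?V"
    \<comment> \<open>A common class has possibly different representatives; saturation moves
      \<open>b\<close> into the first neighbourhood as well.\<close>
    then obtain a b where ab: "a \<in> nbhd Gs (K, w, l) \<epsilon>" "b \<in> nbhd Gs (K', w', l') \<epsilon>" "?q a = ?q b"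
      by (auto simp: disjnt_def)
    have "b \<in> topspace (Mspace Gs)"
      using ab(2) openin_subset[OF openin_nbhd[OF Gs_cubic]] by blast
    then have "(a, b) \<in> Mrel Gs" using eq_equiv_class[OF ab(3) Mrel_equiv] by blast
    then have b: "b \<in> nbhd Gs (K, w, l) \<epsilon>" using sat[OF ab(1)] by blast
    have "tcurve_iso (K, w, l) (K', w', l')"
      by (rule nbhd_disjoint[where x = b and Gs = Gs and \<epsilon> = \<epsilon>])
         (erule \<epsilon>(2) | erule \<epsilon>(3) | erule (2) \<epsilon>(4) | fact b | fact ab(2))+
    then show False using not_iso by (simp add: K K')
  qed
  ultimately show "\<exists>U V. openin (Mtrop Gs) U \<and> openin (Mtrop Gs) V \<and> X \<in> U \<and> Y \<in> V \<and> disjnt U V"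
    by blast
qed

end

theorem theorem3p21:
  fixes g n :: nat and Gs :: "(nat, nat) lgraph set"
  assumes "2 * int g - 2 + int n \<ge> 1"
    and "cubic_representatives g n Gs"
  shows
    "bij_betw (class_at g n) (topspace (Mtrop Gs))
       (tcurve_classes g n :: (nat, nat) tcurve set set)
     \<and>
     (Mreg Gs = (\<Union>G\<in>Gs. Mcell Gs G) \<and> disjoint_family_on (Mcell Gs) Gs \<and>
      openin (Mtrop Gs) (Mreg Gs) \<and> Mtrop Gs closure_of Mreg Gs = topspace (Mtrop Gs))
     \<and>
     (openin (Mtrop Gs) (Mpure Gs) \<and> Mtrop Gs closure_of Mpure Gs = topspace (Mtrop Gs))
     \<and>
     Hausdorff_space (Mtrop Gs)"
  using class_at_bij[OF assms(2)] Mreg_eq_Union[OF assms(2)] Mcell_disjoint[OF assms(2)]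
    openin_Mreg[OF assms(2)] Mreg_dense[OF assms(2)] openin_Mpure[OF assms(2)]
    Mpure_dense[OF assms(2)] Hausdorff_Mtrop[OF assms(2)] by blast

end
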